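(* Let $\kappa\in\mathbb R$. For every sequence $t_0,t_1,\ldots$ of nested triangles in $M^2_\kappa$ with $t_0$ non-degenerate, there exist constants $l_\alpha,L_\alpha>0$ such that for all $n\in\mathbb N$ $$\alpha_0\cdot l_\alpha<\alpha_n<\alpha_0\cdot L_\alpha .$$ In addition, $l_\alpha$ (resp. $L_\alpha$) can be chosen so as to approach $1$ from below (resp. above) as all the side lengths of $t_0$ become small; that is, for every $\varepsilon>0$ there is $\eta>0$ such that if all side lengths of $t_0$ are less than $\eta$, then the constants can be chosen with $1-\varepsilon<l_\alpha<1<L_\alpha<1+\varepsilon$.
   Context: $M_\kappa^2$ denotes the complete simply connected surface of constant curvature $\kappa$. All geodesics are minimal. A geodesic triangle is a triple of points (vertices) together with the three geodesic segments joining them pairwise; if $\kappa>0$ the three vertices are required to lie in a common open hemisphere. Non-degenerate means the vertices do not lie on a common geodesic line (great circle if $\kappa>0$). The medial triangle subdivision of a geodesic triangle is its subdivision into 4 geodesic triangles (three outer ones and one innermost one) obtained by pairwise joining the midpoints of its three sides by geodesic segments. A sequence of nested triangles is a sequence of geodesic triangles $t_0,t_1,t_2,\ldots$ such that, for each $n$, $t_{n+1}$ is one of the 4 triangles of the medial triangle subdivision of $t_n$. The sides of $t_n$ (and, by abuse of notation, their lengths) are denoted $a_n,b_n,c_n$. The labels of $t_0$ are chosen arbitrarily and are propagated as follows. (a) If $t_{n+1}$ is the innermost triangle, each side of $t_{n+1}$ is named after the only side of $t_n$ it does not intersect (e.g. $a_{n+1}$ is the side of $t_{n+1}$ not intersecting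 $a_n$); it is then called the parallel side of that side of $t_n$. (b) If $t_{n+1}$ is an outer triangle, the two sides of $t_{n+1}$ contained in sides of $t_n$ inherit the letter of the side containing them, and the remaining side of $t_{n+1}$ is named as in (a), after the side of $t_n$ it does not intersect. The angle of $t_n$ opposite to $a_n$ (resp. $b_n$, $c_n$) is denoted $\alpha_n$ (resp. $\beta_n$, $\gamma_n$). *)

theory Defs
  imports "HOL-Analysis.Analysis"
begin

text \<open>
  The complete simply connected surface of constant curvature \<open>\<kappa>\<close> is modelled inside
  \<open>real^3\<close>: for \<open>\<kappa> > 0\<close> it is the unit sphere with the angular metric divided by \<open>sqrt \<kappa>\<close>,
  for \<open>\<kappa> = 0\<close> the Euclidean plane (at height 1), and for \<open>\<kappa> < 0\<close> the upper sheet of the unit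
  hyperboloid with the hyperbolic metric divided by \<open>sqrt (- \<kappa>)\<close>.
\<close>

definition model_form :: "real \<Rightarrow> real^3 \<Rightarrow> real^3 \<Rightarrow> real" where
  "model_form \<kappa> x y = x$1 * y$1 + x$2 * y$2 + sgn \<kappa> * (x$3 * y$3)"

definition model_space :: "real \<Rightarrow> (real^3) set" where
  "model_space \<kappa> =
     (if \<kappa> > 0 then {x. model_form \<kappa> x x = 1}
      else if \<kappa> = 0 then {x. x$3 = 1}
      else {x. model_form \<kappa> x x = - 1 \<and> x$3 > 0})"

definition model_dist :: "real \<Rightarrow> real^3 \<Rightarrow> real^3 \<Rightarrow> real" where
  "model_dist \<kappa> x y =
     (if \<kappa> > 0 then arccos (model_form \<kappa> x y) / sqrt \<kappa>
      else if \<kappa> = 0 then dist x y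
      else arcosh (- model_form \<kappa> x y) / sqrt (- \<kappa>))"

text \<open>
  Tangent vectors are normalised with respect to \<^term>\<open>model_form \<kappa>\<close>, i.e. before the metric is
  rescaled; the rescaling is conformal, so angles are unaffected, and it is accounted for in the
  time parameter of the geodesics below, which have unit speed for \<^term>\<open>model_dist \<kappa>\<close>.
\<close>

definition unit_tangent :: "real \<Rightarrow> real^3 \<Rightarrow> (real^3) set" where
  "unit_tangent \<kappa> p =
     {u. (if \<kappa> = 0 then u$3 = 0 else model_form \<kappa> p u = 0) \<and> model_form \<kappa> u u = 1}"

definition geod :: "real \<Rightarrow> real^3 \<Rightarrow> real^3 \<Rightarrow> real \<Rightarrow> real^3" where
  "geod \<kappa> p u t =
     (if \<kappa> > 0 then cos (sqrt \<kappa> * t) *\<^sub>R p + sin (sqrt \<kappa> * t) *\<^sub>R u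
      else if \<kappa> = 0 then p + t *\<^sub>R u
      else cosh (sqrt (- \<kappa>) * t) *\<^sub>R p + sinh (sqrt (- \<kappa>) * t) *\<^sub>R u)"

definition geodesic_line :: "real \<Rightarrow> (real^3) set \<Rightarrow> bool" where
  "geodesic_line \<kappa> S \<longleftrightarrow>
     (\<exists>p \<in> model_space \<kappa>. \<exists>u \<in> unit_tangent \<kappa> p. S = range (geod \<kappa> p u))"

text \<open>
  The initial vector is well defined whenever \<open>p \<noteq> q\<close> are joined by a unique minimal geodesic,
  which excludes only antipodal points on the sphere.
\<close>

definition initial_vector :: "real \<Rightarrow> real^3 \<Rightarrow> real^3 \<Rightarrow> real^3" where
  "initial_vector \<kappa> p q =
     (THE u. u \<in> unit_tangent \<kappa> p \<and> geod \<kappa> p u (model_dist \<kappa> p q) = q)"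

definition geod_angle :: "real \<Rightarrow> real^3 \<Rightarrow> real^3 \<Rightarrow> real^3 \<Rightarrow> real" where
  "geod_angle \<kappa> p q r =
     arccos (model_form \<kappa> (initial_vector \<kappa> p q) (initial_vector \<kappa> p r))"

definition is_midpoint :: "real \<Rightarrow> real^3 \<Rightarrow> real^3 \<Rightarrow> real^3 \<Rightarrow> bool" where
  "is_midpoint \<kappa> m x y \<longleftrightarrow> m \<in> model_space \<kappa> \<and>
     model_dist \<kappa> x m = model_dist \<kappa> x y / 2 \<and> model_dist \<kappa> m y = model_dist \<kappa> x y / 2"

text \<open>
  A labelled triangle is given by its vertices \<open>(A, B, C)\<close>; side \<open>a\<close> is the one opposite to \<open>A\<close>,
  that is, the segment joining \<open>B\<close> and \<open>C\<close>, and similarly for \<open>b\<close> and \<open>c\<close>.  The sides need not be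
  recorded: within an open hemisphere, and everywhere if \<open>\<kappa> \<le> 0\<close>, the minimal geodesic segment
  between two points is unique.
\<close>

type_synonym triangle = "(real^3) \<times> (real^3) \<times> (real^3)"

fun geodesic_triangle :: "real \<Rightarrow> triangle \<Rightarrow> bool" where
  "geodesic_triangle \<kappa> (A, B, C) \<longleftrightarrow>
     A \<in> model_space \<kappa> \<and> B \<in> model_space \<kappa> \<and> C \<in> model_space \<kappa> \<and>
     (\<kappa> > 0 \<longrightarrow> (\<exists>w \<in> model_space \<kappa>.
        model_form \<kappa> w A > 0 \<and> model_form \<kappa> w B > 0 \<and> model_form \<kappa> w C > 0))"

fun nondegenerate :: "real \<Rightarrow> triangle \<Rightarrow> bool" where
  "nondegenerate \<kappa> (A, B, C) \<longleftrightarrow> \<not> (\<exists>S. geodesic_line \<kappa> S \<and> {A, B, C} \<subseteq> S)"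

fun side_a :: "real \<Rightarrow> triangle \<Rightarrow> real" where
  "side_a \<kappa> (A, B, C) = model_dist \<kappa> B C"

fun side_b :: "real \<Rightarrow> triangle \<Rightarrow> real" where
  "side_b \<kappa> (A, B, C) = model_dist \<kappa> C A"

fun side_c :: "real \<Rightarrow> triangle \<Rightarrow> real" where
  "side_c \<kappa> (A, B, C) = model_dist \<kappa> A B"

fun angle_alpha :: "real \<Rightarrow> triangle \<Rightarrow> real" where
  "angle_alpha \<kappa> (A, B, C) = geod_angle \<kappa> A B C"

text \<open>
  Below, \<open>X\<close>, \<open>Y\<close>, \<open>Z\<close> are the midpoints of the sides \<open>a\<close>, \<open>b\<close>, \<open>c\<close>.  The order of the vertices
  encodes the propagation of the labels.  In the innermost triangle the side not meeting \<open>a\<close> is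
  \<open>YZ\<close>, so it is the new \<open>a\<close> and its opposite vertex \<open>X\<close> comes first.  In the outer triangle at
  \<open>A\<close> the sides \<open>AZ\<close> and \<open>AY\<close> are contained in \<open>c\<close> and \<open>b\<close> and inherit these letters, while \<open>YZ\<close>
  does not meet \<open>a\<close> and becomes the new \<open>a\<close>; the vertices opposite to the new \<open>a\<close>, \<open>b\<close>, \<open>c\<close> are
  thus \<open>A\<close>, \<open>Z\<close>, \<open>Y\<close>.
\<close>

fun medial_child :: "real \<Rightarrow> triangle \<Rightarrow> triangle \<Rightarrow> bool" where
  "medial_child \<kappa> (A, B, C) T \<longleftrightarrow>
     (\<exists>X Y Z. is_midpoint \<kappa> X B C \<and> is_midpoint \<kappa> Y C A \<and> is_midpoint \<kappa> Z A B \<and>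
        T \<in> {(X, Y, Z), (A, Z, Y), (Z, B, X), (Y, X, C)})"

definition nested_triangles :: "real \<Rightarrow> (nat \<Rightarrow> triangle) \<Rightarrow> bool" where
  "nested_triangles \<kappa> t \<longleftrightarrow>
     (\<forall>n. geodesic_triangle \<kappa> (t n)) \<and> (\<forall>n. medial_child \<kappa> (t n) (t (Suc n)))"

end

theory Submission
  imports Defs
begin

text \<open>
  All three geometries are treated at once. With \<open>s = sgn \<kappa>\<close>, a side is measured by its haversine,
  i.e. \<open>sin\<^sup>2\<close>, \<open>sinh\<^sup>2\<close> or the square of half its (rescaled) length. Laws of
  cosines, midpoints and midlines are then given by formulas that are the same for
  \<open>s = 1\<close>, \<open>s = 0\<close> and \<open>s = - 1\<close>, so that one subdivision step becomes an explicit map on triples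
  \<open>(p, q, w)\<close> of haversines, and \<open>\<alpha>\<close> an explicit function \<open>ang\<close> of \<open>(s, p, q, w)\<close>.

  In the flat plane \<open>\<alpha>\<close> never changes. In curved geometry the angle at \<open>A\<close> is still inherited
  exactly by the outer triangle at \<open>A\<close>; for each of the other three children, if \<open>M\<close>
  bounds all haversines of the parent, the new angle satisfies
  \<open>sin \<alpha>' = (1 + O(M)) sin \<alpha>\<close> and \<open>cos \<alpha>' = cos \<alpha> + O(M)\<close>, uniformly in the shape of the triangle.
  As \<open>sin (\<alpha>' - \<alpha>)\<close> is \<open>sin \<alpha>\<close> times a quantity of size \<open>O(M)\<close>, the change of angle is
  \<open>O(M \<alpha>)\<close>: a relative error, even for arbitrarily thin triangles (\<open>ang_step\<close>).
  Uniformity rests on an exact cancellation: both quantities for the child are expressed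
  through the same Euclidean cosine \<open>(q + w - p) / (2 sqrt (q w))\<close> and the same Gram determinant as
  for the parent (\<open>outer_identities\<close>, \<open>inner_identities\<close>).

  Once the sides are small, each subdivision at least halves a common bound for the haversines, so the relative errors
  form a geometric series bounded by a multiple of the initial \<open>M\<close> (\<open>tail_drift\<close>). This yields
  the assertion on small triangles at once. For a large triangle it remains to see that the sides
  eventually become small (\<open>nested_small\<close>), since the finitely many earlier angles are positive.
  For \<open>\<kappa> \<le> 0\<close> the halving holds for every size. On the sphere it can fail, and the gnomonic
  projection from the centre of a hemisphere containing \<open>t\<^sub>0\<close> is used instead: it turns geodesic midpoints
  into points that divide a Euclidean segment in a ratio bounded away from \<open>0\<close> and \<open>1\<close>, whence
  the diameters of the projected triangles shrink by a constant factor below \<open>1\<close>.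
\<close>

section \<open>Triangles described by haversines\<close>

text \<open>
  In a geometry of curvature sign \<open>s\<close>, let a side of length \<open>x\<close> (in units in which the curvature
  is \<open>s\<close>) have haversine \<open>p\<close>, that is \<open>sin\<^sup>2 (x/2)\<close>, \<open>x\<^sup>2/4\<close> or \<open>sinh\<^sup>2 (x/2)\<close>. Then \<open>halfcos s p\<close> is
  \<open>cos (x/2)\<close>, \<open>1\<close> or \<open>cosh (x/2)\<close>, and \<open>gsin s p\<close> is \<open>sin x\<close>, \<open>x\<close> or \<open>sinh x\<close>.
\<close>

definition halfcos :: "real \<Rightarrow> real \<Rightarrow> real" where
  "halfcos s p = sqrt (1 - s * p)"

definition gsin :: "real \<Rightarrow> real \<Rightarrow> real" where
  "gsin s p = 2 * sqrt (p * (1 - s * p))"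

text \<open>
  For a triangle \<open>ABC\<close> whose sides \<open>a\<close>, \<open>b\<close>, \<open>c\<close> have the haversines \<open>p\<close>, \<open>q\<close>, \<open>w\<close>, let \<open>U\<close> and \<open>V\<close> be the
  tangential parts of \<open>B\<close> and \<open>C\<close> at \<open>A\<close>, of lengths \<open>gsin s w\<close> and \<open>gsin s q\<close>. Half their inner
  product is \<open>gprod\<close>, a quarter of their Gram determinant is \<open>gram\<close>, and the angle between
  them is \<open>ang\<close>. Unlike \<open>gprod\<close>, the determinant \<open>gram\<close> does not depend on the choice of
  the vertex \<open>A\<close>.
\<close>

definition gprod :: "real \<Rightarrow> real \<Rightarrow> real \<Rightarrow> real \<Rightarrow> real" where
  "gprod s p q w = q + w - p - 2 * s * q * w"

definition gram :: "real \<Rightarrow> real \<Rightarrow> real \<Rightarrow> real \<Rightarrow> real" where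
  "gram s p q w = 4 * q * w * (1 - s * q) * (1 - s * w) - (gprod s p q w)\<^sup>2"

definition ang :: "real \<Rightarrow> real \<Rightarrow> real \<Rightarrow> real \<Rightarrow> real" where
  "ang s p q w = arccos (2 * gprod s p q w / (gsin s q * gsin s w))"

text \<open>
  The haversine of half a side of haversine \<open>p\<close>.
\<close>

definition half :: "real \<Rightarrow> real \<Rightarrow> real" where
  "half s p = p / (2 * (1 + halfcos s p))"

text \<open>
  The haversine of the segment that joins the midpoints of the sides with haversines \<open>p\<close> and \<open>w\<close>,
  where \<open>q\<close> belongs to the third side. In the plane this is \<open>q / 4\<close>.
\<close>

definition midline :: "real \<Rightarrow> real \<Rightarrow> real \<Rightarrow> real \<Rightarrow> real" where
  "midline s q p w =
     (q - s * ((w - p) / (halfcos s p + halfcos s w))\<^sup>2) / (4 * halfcos s p * halfcos s w)"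

text \<open>
  The haversines of a non-degenerate triangle; the conditions \<open>s * p < 1\<close> exclude
  antipodal vertices on the sphere.
\<close>

definition admissible :: "real \<Rightarrow> real \<Rightarrow> real \<Rightarrow> real \<Rightarrow> bool" where
  "admissible s p q w \<longleftrightarrow> s \<in> {-1, 0, 1} \<and> 0 < p \<and> 0 < q \<and> 0 < w \<and>
     s * p < 1 \<and> s * q < 1 \<and> s * w < 1 \<and> 0 < gram s p q w"

lemma gram_swap: "gram s p q w = gram s p w q" "gram s p q w = gram s q p w"
  unfolding gram_def gprod_def by algebra+

lemma admissible_swap:
  "admissible s p q w \<Longrightarrow> admissible s p w q" "admissible s p q w \<Longrightarrow> admissible s q p w"
  unfolding admissible_def using gram_swap by metis+

lemma ang_swap: "ang s p q w = ang s p w q"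
  unfolding ang_def gprod_def by (simp add: algebra_simps)

lemma midline_swap: "midline s q p w = midline s q w p"
  unfolding midline_def by (simp add: power_divide power2_commute[of w p] algebra_simps)

lemma halfcos_pos: "s * p < 1 \<Longrightarrow> 0 < halfcos s p"
  unfolding halfcos_def by simp

lemma halfcos_sq: "s * p < 1 \<Longrightarrow> (halfcos s p)\<^sup>2 = 1 - s * p"
  unfolding halfcos_def by simp

lemma gsin_pos: "0 < p \<Longrightarrow> s * p < 1 \<Longrightarrow> 0 < gsin s p"
  unfolding gsin_def by simp

lemma gsin_sq: "0 < p \<Longrightarrow> s * p < 1 \<Longrightarrow> (gsin s p)\<^sup>2 = 4 * (p * (1 - s * p))"
  unfolding gsin_def by (simp add: power_mult_distrib)

lemma gsin_eq: "0 < p \<Longrightarrow> s * p < 1 \<Longrightarrow> gsin s p = 2 * (sqrt p * halfcos s p)"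
  unfolding gsin_def halfcos_def by (simp add: real_sqrt_mult)

lemma cos_sin_ang:
  assumes "admissible s p q w"
  shows "cos (ang s p q w) = 2 * gprod s p q w / (gsin s q * gsin s w)"
    and "sin (ang s p q w) = 2 * sqrt (gram s p q w) / (gsin s q * gsin s w)"
    and "0 < ang s p q w" "ang s p q w < pi"
proof -
  define x where "x = 2 * gprod s p q w / (gsin s q * gsin s w)"
  have pos: "0 < q" "0 < w" "s * q < 1" "s * w < 1" "0 < gram s p q w"
    using assms(1) by (auto simp: admissible_def)
  have R: "0 < gsin s q * gsin s w" using pos by (simp add: gsin_pos)
  have Rsq: "(gsin s q * gsin s w)\<^sup>2 = 16 * (q * w * (1 - s * q) * (1 - s * w))"
    using pos by (simp add: gsin_sq power_mult_distrib)
  have *: "1 - x\<^sup>2 = 4 * gram s p q w / (gsin s q * gsin s w)\<^sup>2"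
  proof -
    have "(gsin s q * gsin s w)\<^sup>2 - (2 * gprod s p q w)\<^sup>2 = 4 * gram s p q w"
      unfolding Rsq gram_def by algebra
    moreover have "1 - x\<^sup>2 = ((gsin s q * gsin s w)\<^sup>2 - (2 * gprod s p q w)\<^sup>2) / (gsin s q * gsin s w)\<^sup>2"
      using R unfolding x_def power_divide by (auto simp: diff_divide_distrib simp del: power_mult_distrib)
    ultimately show ?thesis by simp
  qed
  have "4 * gram s p q w / (gsin s q * gsin s w)\<^sup>2 > 0"
    using pos(5) R by (intro divide_pos_pos zero_less_power) simp_all
  then have "x\<^sup>2 < 1" using * by linarith
  then have x1: "-1 < x" "x < 1" using abs_square_less_1[of x] by auto
  show "cos (ang s p q w) = 2 * gprod s p q w / (gsin s q * gsin s w)"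
    using x1 unfolding ang_def x_def[symmetric] by simp
  have "sin (ang s p q w) = sqrt (1 - x\<^sup>2)"
    using x1 unfolding ang_def x_def[symmetric] by (simp add: sin_arccos)
  also have "\<dots> = 2 * sqrt (gram s p q w) / (gsin s q * gsin s w)"
    using R unfolding * by (simp add: real_sqrt_divide real_sqrt_mult)
  finally show "sin (ang s p q w) = 2 * sqrt (gram s p q w) / (gsin s q * gsin s w)" .
  show "0 < ang s p q w" "ang s p q w < pi"
    using x1 arccos_lt_bounded[of x] unfolding ang_def x_def[symmetric] by auto
qed

lemma half_props:
  assumes "0 < p" "s * p < 1"
  shows "0 < half s p" "1 - 2 * s * half s p = halfcos s p" "gsin s (half s p) = sqrt p"
    "s * half s p < 1" "half s p \<le> p / 2"
proof -
  define m where "m = halfcos s p"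
  have m: "m > 0" "m\<^sup>2 = 1 - s * p" using assms halfcos_pos halfcos_sq by (auto simp: m_def)
  show "0 < half s p" using m assms by (simp add: half_def m_def)
  show c: "1 - 2 * s * half s p = halfcos s p"
    using m unfolding half_def m_def[symmetric] by (simp add: field_simps power2_eq_square)
  have e: "1 - s * half s p = (1 + m) / 2" using c unfolding m_def by simp
  have "4 * (half s p * ((1 + m) / 2)) = p"
    using m unfolding half_def m_def[symmetric] by (simp add: field_simps)
  then have "4 * (half s p * (1 - s * half s p)) = p" unfolding e by simp
  moreover have "gsin s (half s p) = sqrt (4 * (half s p * (1 - s * half s p)))"
    unfolding gsin_def by (simp add: real_sqrt_mult)
  ultimately show "gsin s (half s p) = sqrt p" by simp
  have "0 < 1 - s * half s p" unfolding e using m(1) by simp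
  then show "s * half s p < 1" by simp
  show "half s p \<le> p / 2" using m assms unfolding half_def m_def[symmetric]
    by (simp add: field_simps)
qed

text \<open>
  The numerator is symmetric in the three sides, because it is a quarter of
  \<open>1 + cos a + cos b + cos c\<close> (for \<open>s = 1\<close>). This is why the inner triangle has a simple Gram determinant.
\<close>

lemma midline_cos:
  assumes "s \<in> {-1, 0, 1}" "s * p < 1" "s * w < 1"
  shows "1 - 2 * s * midline s q p w = (1 - s * (p + q + w) / 2) / (halfcos s p * halfcos s w)"
proof -
  define a c where "a = halfcos s p" and "c = halfcos s w"
  have m: "a > 0" "a\<^sup>2 = 1 - s * p" "c > 0" "c\<^sup>2 = 1 - s * w"
    using assms halfcos_pos halfcos_sq by (auto simp: a_def c_def)
  have "(a - c) * (a + c) = s * (w - p)" using m by (simp add: algebra_simps power2_eq_square)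
  then have "s * ((w - p) / (a + c)) = a - c" using m by (simp add: field_simps)
  moreover have "s * (s * ((w - p) / (a + c))\<^sup>2) = (s * ((w - p) / (a + c)))\<^sup>2"
    by algebra
  ultimately have *: "s * (s * ((w - p) / (a + c))\<^sup>2) = (a - c)\<^sup>2" by simp
  have "1 - 2 * s * midline s q p w = 1 - (s * q - (a - c)\<^sup>2) / (2 * (a * c))"
    unfolding midline_def a_def[symmetric] c_def[symmetric]
    using * m by (simp add: field_simps)
  also have "\<dots> = (a\<^sup>2 + c\<^sup>2 - s * q) / (2 * (a * c))"
    using m by (simp add: field_simps power2_eq_square)
  also have "\<dots> = (1 - s * (p + q + w) / 2) / (a * c)"
    using m by (simp add: field_simps)
  finally show ?thesis by (simp add: a_def c_def)
qed

text \<open>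
  For \<open>s \<noteq> 0\<close> the identities below are most easily verified in the variables \<open>cos a = 1 - 2 s p\<close>
  (or \<open>cosh a\<close>), in which, up to constant factors, \<open>gram\<close> is the classical Gram determinant of the
  vertices and \<open>gprod\<close> the numerator in the law of cosines.
\<close>

lemma gram_cos: "s \<in> {-1, 1} \<Longrightarrow> 4 * gram s p q w = 1 + 2 * (1 - 2 * s * p) * (1 - 2 * s * q) * (1 - 2 * s * w)
   - (1 - 2 * s * p)\<^sup>2 - (1 - 2 * s * q)\<^sup>2 - (1 - 2 * s * w)\<^sup>2"
  unfolding gram_def gprod_def by (auto simp: algebra_simps power2_eq_square)

lemma gprod_cos: "s \<in> {-1, 1} \<Longrightarrow> 2 * s * gprod s p q w = (1 - 2 * s * p) - (1 - 2 * s * q) * (1 - 2 * s * w)"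
  unfolding gprod_def by (auto simp: algebra_simps power2_eq_square)

lemma flat_case: "halfcos 0 p = 1" "half 0 p = p / 4" "midline 0 q p w = q / 4"
  by (simp_all add: halfcos_def half_def midline_def)

text \<open>
  In the outer triangle at \<open>B\<close>, the new vertices are \<open>B\<close> and the midpoints \<open>(B + C) / (2 cos (a/2))\<close>
  and \<open>(A + B) / (2 cos (c/2))\<close>; the Gram determinant scales by the squares of these
  normalising factors. The second identity gives the angle at the midpoint of \<open>AB\<close>, which is the new vertex \<open>A\<close>: its numerator is exactly
  the Euclidean one, so no cancellation is lost when \<open>b\<close> is much shorter than \<open>a\<close> and \<open>c\<close>.
  The third identity concerns the vertex \<open>B\<close> itself, where the angle is unchanged.
\<close>

lemma outer_identities:
  assumes "admissible s p q w"
  defines "a \<equiv> halfcos s p" and "c \<equiv> halfcos s w"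
  shows "gram s (half s p) (midline s q p w) (half s w) = gram s p q w / (16 * a\<^sup>2 * c\<^sup>2)"
    and "gprod s (half s p) (midline s q p w) (half s w) = (q + w - p) / (4 * a)"
    and "gprod s (midline s q p w) (half s p) (half s w) = gprod s q p w / (4 * a * c)"
proof -
  have A: "s \<in> {-1,0,1}" "0 < p" "0 < w" "s * p < 1" "s * w < 1" using assms(1) by (auto simp: admissible_def)
  have m: "a > 0" "a\<^sup>2 = 1 - s * p" "c > 0" "c\<^sup>2 = 1 - s * w"
    unfolding a_def c_def using A(4,5) by (simp_all only: halfcos_pos halfcos_sq)
  define \<sigma> where "\<sigma> = 1 - s * (p + q + w) / 2"
  have x: "1 - 2 * s * half s p = a" "1 - 2 * s * half s w = c"
     "1 - 2 * s * midline s q p w = \<sigma> / (a * c)"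
    unfolding a_def c_def \<sigma>_def by (fact half_props(2)[OF A(2,4)] half_props(2)[OF A(3,5)]
      midline_cos[OF A(1,4,5)])+
  have "gram s (half s p) (midline s q p w) (half s w) = gram s p q w / (16 * a\<^sup>2 * c\<^sup>2) \<and>
      gprod s (half s p) (midline s q p w) (half s w) = (q + w - p) / (4 * a) \<and>
      gprod s (midline s q p w) (half s p) (half s w) = gprod s q p w / (4 * a * c)"
  proof (cases "s = 0")
    case True
    then have "a = 1" "c = 1" by (auto simp: a_def c_def flat_case)
    with True show ?thesis unfolding gram_def gprod_def
      by (simp add: flat_case power2_eq_square field_simps)
  next
    case False
    then have s: "s \<in> {-1, 1}" using A by auto
    then have ss: "s * s = 1" by auto
    have y: "1 - 2 * s * p = 2 * a\<^sup>2 - 1" "1 - 2 * s * w = 2 * c\<^sup>2 - 1"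
       "1 - 2 * s * q = 4 * \<sigma> - 2 * a\<^sup>2 - 2 * c\<^sup>2 + 1"
      using m by (auto simp: \<sigma>_def field_simps)
    have "4 * (gram s (half s p) (midline s q p w) (half s w) * (16 * a\<^sup>2 * c\<^sup>2)) =
       (16 * a\<^sup>2 * c\<^sup>2) * (1 + 2 * \<sigma> - a\<^sup>2 - c\<^sup>2) - 16 * \<sigma>\<^sup>2"
    proof -
      define y where "y = \<sigma> / (a * c)"
      have "\<sigma> = a * y * c" using m(1,3) by (simp add: y_def)
      then show ?thesis
        using gram_cos[OF s, of "half s p" "midline s q p w" "half s w", unfolded x, folded y_def]
        by algebra
    qed
    also have "\<dots> = 4 * gram s p q w"
      unfolding gram_cos[OF s] y by algebra
    finally have 1: "gram s (half s p) (midline s q p w) (half s w) = gram s p q w / (16 * a\<^sup>2 * c\<^sup>2)"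
      using m(1,3) by (simp add: field_simps)
    have "2 * s * gprod s (half s p) (midline s q p w) (half s w) = a - \<sigma> / a"
      unfolding gprod_cos[OF s] x using m by (simp add: field_simps)
    also have "\<dots> = (a\<^sup>2 - \<sigma>) / a" using m by (simp add: field_simps power2_eq_square)
    also have "a\<^sup>2 - \<sigma> = s * (q + w - p) / 2" unfolding m \<sigma>_def by (simp add: field_simps)
    finally have "2 * s * gprod s (half s p) (midline s q p w) (half s w) = 2 * s * ((q + w - p) / (4 * a))"
      by simp
    then have 2: "gprod s (half s p) (midline s q p w) (half s w) = (q + w - p) / (4 * a)"
      using False by (simp del: times_divide_eq_right)
    have "2 * s * gprod s (midline s q p w) (half s p) (half s w) = \<sigma> / (a * c) - a * c"
      unfolding gprod_cos[OF s] x by simp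
    also have "\<dots> = (\<sigma> - a\<^sup>2 * c\<^sup>2) / (a * c)" using m by (simp add: field_simps power2_eq_square)
    also have "\<sigma> - a\<^sup>2 * c\<^sup>2 = s * gprod s q p w / 2" unfolding m \<sigma>_def gprod_def
      using ss by (simp add: field_simps)
    finally have "2 * s * gprod s (midline s q p w) (half s p) (half s w) = 2 * s * (gprod s q p w / (4 * a * c))"
      by simp
    then have 3: "gprod s (midline s q p w) (half s p) (half s w) = gprod s q p w / (4 * a * c)"
      using False by (simp del: times_divide_eq_right)
    from 1 2 3 show ?thesis by simp
  qed
  then show "gram s (half s p) (midline s q p w) (half s w) = gram s p q w / (16 * a\<^sup>2 * c\<^sup>2)"
     "gprod s (half s p) (midline s q p w) (half s w) = (q + w - p) / (4 * a)"
    "gprod s (midline s q p w) (half s p) (half s w) = gprod s q p w / (4 * a * c)" by simp_all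
qed

text \<open>
  The inner triangle has the three midpoints as vertices. Again the numerator of the cosine is
  the Euclidean one, up to a factor that tends to \<open>1 / 4\<close> for small triangles.
\<close>

lemma inner_identities:
  assumes "admissible s p q w"
  defines "a \<equiv> halfcos s p" and "b \<equiv> halfcos s q" and "c \<equiv> halfcos s w"
  shows "gram s (midline s p q w) (midline s q p w) (midline s w p q)
           = gram s p q w / (16 * a\<^sup>2 * b\<^sup>2 * c\<^sup>2)"
    and "gprod s (midline s p q w) (midline s q p w) (midline s w p q)
           = (1 - s * (p + q + w) / 2) * (q + w - p) / (4 * a\<^sup>2 * b * c)"
proof -
  have A: "s \<in> {-1,0,1}" "0 < p" "0 < w" "0 < q" "s * p < 1" "s * q < 1" "s * w < 1"
    using assms(1) by (auto simp: admissible_def)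
  have m: "a > 0" "a\<^sup>2 = 1 - s * p" "b > 0" "b\<^sup>2 = 1 - s * q" "c > 0" "c\<^sup>2 = 1 - s * w"
    unfolding a_def b_def c_def using A(5-7) by (simp_all only: halfcos_pos halfcos_sq)
  define \<sigma> where "\<sigma> = 1 - s * (p + q + w) / 2"
  have x: "1 - 2 * s * midline s p q w = \<sigma> / (b * c)"
     "1 - 2 * s * midline s q p w = \<sigma> / (a * c)"
     "1 - 2 * s * midline s w p q = \<sigma> / (a * b)"
    using midline_cos[OF A(1) A(6) A(7), of p] midline_cos[OF A(1) A(5) A(7), of q]
      midline_cos[OF A(1) A(5) A(6), of w]
    unfolding a_def b_def c_def \<sigma>_def by (simp_all only: ac_simps)
  have "gram s (midline s p q w) (midline s q p w) (midline s w p q)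
           = gram s p q w / (16 * a\<^sup>2 * b\<^sup>2 * c\<^sup>2) \<and>
      gprod s (midline s p q w) (midline s q p w) (midline s w p q)
           = \<sigma> * (q + w - p) / (4 * a\<^sup>2 * b * c)"
  proof (cases "s = 0")
    case True
    then have "a = 1" "b = 1" "c = 1" "\<sigma> = 1" by (auto simp: a_def b_def c_def \<sigma>_def flat_case)
    with True show ?thesis unfolding gram_def gprod_def
      by (simp add: flat_case power2_eq_square field_simps)
  next
    case False
    then have s: "s \<in> {-1, 1}" using A by auto
    \<comment> \<open>Only \<open>a\<close>, \<open>c\<close> and \<open>\<sigma>\<close> remain as independent variables.\<close>
    have b2: "b\<^sup>2 = 2 * \<sigma> + 1 - a\<^sup>2 - c\<^sup>2" unfolding m \<sigma>_def by (simp add: algebra_simps)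
    have y: "1 - 2 * s * p = 2 * a\<^sup>2 - 1" "1 - 2 * s * w = 2 * c\<^sup>2 - 1"
       "1 - 2 * s * q = 2 * b\<^sup>2 - 1"
      using m by (auto simp: algebra_simps)
    have "4 * (gram s (midline s p q w) (midline s q p w) (midline s w p q) * (16 * a\<^sup>2 * b\<^sup>2 * c\<^sup>2)) =
       16 * (a\<^sup>2 * b\<^sup>2 * c\<^sup>2 + 2 * \<sigma>^3 - \<sigma>\<^sup>2 * (a\<^sup>2 + b\<^sup>2 + c\<^sup>2))"
    proof -
      have "(\<sigma> / (b * c)) * (\<sigma> / (a * c)) * (\<sigma> / (a * b)) * (a\<^sup>2 * b\<^sup>2 * c\<^sup>2) = \<sigma>^3"
        using m(1,3,5) by (simp add: field_simps power2_eq_square power3_eq_cube)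
      moreover have "(\<sigma> / (b * c))\<^sup>2 * (a\<^sup>2 * b\<^sup>2 * c\<^sup>2) = \<sigma>\<^sup>2 * a\<^sup>2"
        "(\<sigma> / (a * c))\<^sup>2 * (a\<^sup>2 * b\<^sup>2 * c\<^sup>2) = \<sigma>\<^sup>2 * b\<^sup>2"
        "(\<sigma> / (a * b))\<^sup>2 * (a\<^sup>2 * b\<^sup>2 * c\<^sup>2) = \<sigma>\<^sup>2 * c\<^sup>2"
        using m(1,3,5) by (simp_all add: field_simps power2_eq_square)
      ultimately show ?thesis
        using gram_cos[OF s, of "midline s p q w" "midline s q p w" "midline s w p q", unfolded x]
        by algebra
    qed
    also have "\<dots> = 4 * gram s p q w"
      unfolding gram_cos[OF s] y b2 by algebra
    finally have 1: "gram s (midline s p q w) (midline s q p w) (midline s w p q)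
           = gram s p q w / (16 * a\<^sup>2 * b\<^sup>2 * c\<^sup>2)"
      using m(1,3,5) by (simp add: field_simps)
    have "2 * s * gprod s (midline s p q w) (midline s q p w) (midline s w p q)
        = \<sigma> * (a\<^sup>2 - \<sigma>) / (a\<^sup>2 * b * c)"
      unfolding gprod_cos[OF s] x using m(1,3,5) by (simp add: field_simps power2_eq_square)
    also have "a\<^sup>2 - \<sigma> = s * (q + w - p) / 2" unfolding m \<sigma>_def by (simp add: field_simps)
    finally have "2 * s * gprod s (midline s p q w) (midline s q p w) (midline s w p q)
        = 2 * s * (\<sigma> * (q + w - p) / (4 * a\<^sup>2 * b * c))"
      by simp
    then have 2: "gprod s (midline s p q w) (midline s q p w) (midline s w p q)
           = \<sigma> * (q + w - p) / (4 * a\<^sup>2 * b * c)"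
      using False by (simp del: times_divide_eq_right)
    from 1 2 show ?thesis by simp
  qed
  then show "gram s (midline s p q w) (midline s q p w) (midline s w p q)
           = gram s p q w / (16 * a\<^sup>2 * b\<^sup>2 * c\<^sup>2)"
    "gprod s (midline s p q w) (midline s q p w) (midline s w p q)
           = (1 - s * (p + q + w) / 2) * (q + w - p) / (4 * a\<^sup>2 * b * c)"
    by (simp_all add: \<sigma>_def)
qed

section \<open>Comparison with Euclidean triangles\<close>

text \<open>
  Multiplicative errors are measured by logarithms, which turns products, quotients and
  square roots of factors close to \<open>1\<close> into sums. The next two lemmas translate to and from
  this scale.
\<close>

lemma abs_ln_one_plus_le:
  fixes t :: real assumes "\<bar>t\<bar> \<le> 1 / 2"
  shows "\<bar>ln (1 + t)\<bar> \<le> 2 * \<bar>t\<bar>"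
proof -
  have "\<bar>ln (1 + t) - t\<bar> \<le> 2 * t\<^sup>2" using assms by (rule abs_ln_one_plus_x_minus_x_bound)
  moreover have "2 * t\<^sup>2 \<le> \<bar>t\<bar>"
    using mult_right_mono[OF assms abs_ge_zero[of t]] by (simp add: power2_eq_square)
  ultimately show ?thesis by linarith
qed

lemma abs_minus_one_le_ln:
  fixes x :: real assumes "0 < x" "\<bar>ln x\<bar> \<le> c" "c \<le> 1 / 2"
  shows "\<bar>x - 1\<bar> \<le> 2 * c"
proof (cases "ln x \<ge> 0")
  case True
  then have "exp (ln x) \<le> 1 + 2 * ln x" using assms by (intro real_exp_bound_lemma) auto
  moreover have "x \<ge> 1" using True assms(1) by simp
  ultimately show ?thesis using assms by simp
next
  case False
  moreover have "1 + ln x \<le> exp (ln x)" by (rule exp_ge_add_one_self)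
  moreover have "x < 1" using False assms(1) by simp
  ultimately show ?thesis using assms by simp
qed

text \<open>
  The sine alone cannot tell \<open>x\<close> from \<open>\<pi> - x\<close>, and the cosine alone has no relative accuracy near
  \<open>0\<close>. Together they suffice: \<open>sin (y - x) = sin x * (\<rho> * cos x - cos y)\<close> is small relative to
  \<open>sin x \<le> x\<close>, while \<open>cos (y - x)\<close> is close to \<open>1\<close>, so that \<open>y - x\<close> is comparable to its sine.
\<close>

lemma angle_compare:
  fixes x y \<rho> c d :: real
  assumes "0 < x" "x < pi" "0 < y" "y < pi" "sin y = \<rho> * sin x"
    and "\<bar>\<rho> - 1\<bar> \<le> c" "\<bar>cos y - cos x\<bar> \<le> d" "c + d \<le> 1 / 2"
  shows "\<bar>y - x\<bar> \<le> 2 * (c + d) * x"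
proof -
  have sx: "0 < sin x" "sin x \<le> 1" "sin x \<le> x" using assms sin_gt_zero sin_x_le_x by auto
  have bnd: "\<bar>\<rho> * cos x - cos y\<bar> \<le> c + d"
  proof -
    have "\<bar>(\<rho> - 1) * cos x\<bar> \<le> c * 1" unfolding abs_mult using assms by (intro mult_mono) auto
    then show ?thesis using assms(7) by (simp add: algebra_simps)
  qed
  have "sin (y - x) = sin x * (\<rho> * cos x - cos y)"
    by (simp add: sin_diff assms(5) algebra_simps)
  then have "\<bar>sin (y - x)\<bar> \<le> sin x * (c + d)"
    using sx bnd by (simp add: abs_mult)
  also have "\<dots> \<le> x * (c + d)" using sx bnd by (intro mult_right_mono) auto
  finally have s: "\<bar>sin (y - x)\<bar> \<le> (c + d) * x" by (simp add: mult.commute)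
  have "cos (y - x) = 1 + (cos y - cos x) * cos x + (\<rho> - 1) * (sin x)\<^sup>2"
    by (simp add: cos_diff assms(5) sin_squared_eq algebra_simps power2_eq_square)
  moreover have "\<bar>(cos y - cos x) * cos x\<bar> \<le> d * 1" unfolding abs_mult
    using assms by (intro mult_mono) auto
  moreover have "\<bar>(\<rho> - 1) * (sin x)\<^sup>2\<bar> \<le> c * 1" unfolding abs_mult
    using assms sx by (intro mult_mono) (auto simp: power_le_one)
  ultimately have cs: "cos (y - x) \<ge> 1 / 2" using assms(8) by linarith
  define t where "t = \<bar>y - x\<bar>"
  have t: "t < pi" "t \<ge> 0" using assms by (auto simp: t_def)
  have ct: "cos t \<ge> 1/2" "\<bar>sin (y - x)\<bar> = sin t"
  proof -
    from t have "sin t \<ge> 0" by (intro sin_ge_zero) auto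
    then show "\<bar>sin (y - x)\<bar> = sin t"
      unfolding t_def using sin_minus[of "y - x"] by (cases "y \<ge> x") auto
    show "cos t \<ge> 1/2" using cs unfolding t_def by (simp add: abs_if flip: cos_minus[of "y - x"])
  qed
  have "t < pi / 2"
  proof (rule ccontr)
    assume "\<not> t < pi / 2"
    then have "cos t \<le> cos (pi / 2)" using t by (intro cos_monotone_0_pi_le) auto
    then show False using ct by simp
  qed
  then have "arctan (tan t) = t" using t by (intro arctan_tan) auto
  moreover have "tan t \<ge> 0" using t \<open>t < pi/2\<close> by (metis tan_gt_zero tan_zero less_eq_real_def)
  ultimately have "t \<le> tan t" using arctan_le_self by metis
  also have "tan t \<le> sin t / (1 / 2)"
    unfolding tan_def using ct(1) sin_ge_zero[of t] t by (intro frac_le) auto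
  also have "\<dots> = 2 * \<bar>sin (y - x)\<bar>" using ct(2) by simp
  also have "\<dots> \<le> 2 * ((c + d) * x)" using s by (intro mult_left_mono) auto
  finally have "t \<le> 2 * ((c + d) * x)" .
  then show ?thesis by (simp only: t_def mult.assoc)
qed

text \<open>
  A form of the triangle inequality \<open>\<bar>c - a\<bar> \<le> b\<close>: the difference \<open>w - p\<close> of haversines is about
  \<open>(c - a) (c + a) / 4\<close>, and \<open>c + a\<close> is at most of order \<open>sqrt M\<close>. It is extracted from the positivity of the
  Gram determinant, i.e. from \<open>\<bar>cos \<alpha>\<bar> \<le> 1\<close>.
\<close>

lemma side_difference:
  assumes "admissible s p q w" "p \<le> M" "q \<le> M" "w \<le> M" "M \<le> 1 / 512"
  shows "(w - p)\<^sup>2 \<le> 16 * q * M"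
proof -
  note A = assms(1)[unfolded admissible_def]
  have M: "0 < M" using A assms by linarith
  let ?N = "gprod s p q w"
  have f: "0 \<le> 1 - s * q" "1 - s * q \<le> 1 + M" "0 \<le> 1 - s * w" "1 - s * w \<le> 1 + M"
    using A assms by auto
  have "(1 - s * q) * (1 - s * w) \<le> (1 + M) * (1 + M)" using f by (intro mult_mono) auto
  also have "\<dots> \<le> (1 + 1/512) * (1 + 1/512)" using assms M by (intro mult_mono) auto
  finally have g: "(1 - s * q) * (1 - s * w) \<le> 3/2" by simp
  have "?N\<^sup>2 \<le> 4 * (q * w) * ((1 - s * q) * (1 - s * w))" using A by (simp add: gram_def algebra_simps)
  also have "\<dots> \<le> 4 * (q * w) * (3/2)" using A g by (intro mult_left_mono) auto
  also have "\<dots> \<le> 4 * (q * M) * (3/2)" using A assms by simp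
  finally have 1: "?N\<^sup>2 \<le> 6 * (q * M)" by (simp add: ac_simps)
  have "\<bar>q * (1 - 2 * s * w)\<bar> \<le> q * (1 + 2 * M)" unfolding abs_mult
    using A assms by (intro mult_mono) auto
  then have "(q * (1 - 2 * s * w))\<^sup>2 \<le> (q * (1 + 2 * M))\<^sup>2"
    by (metis abs_ge_zero power2_abs power_mono)
  also have "\<dots> \<le> (q * (5/4))\<^sup>2" using A M assms by (intro power_mono mult_left_mono) auto
  also have "\<dots> = q * q * (25/16)" by (simp add: power2_eq_square)
  also have "\<dots> \<le> q * M * (25/16)" using A assms M by (intro mult_right_mono mult_left_mono) auto
  finally have 2: "(q * (1 - 2 * s * w))\<^sup>2 \<le> q * M * (25/16)" .
  have "w - p = ?N - q * (1 - 2 * s * w)" by (simp add: gprod_def algebra_simps)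
  moreover have "(x - y)\<^sup>2 \<le> 2 * x\<^sup>2 + 2 * y\<^sup>2" for x y :: real
    using zero_le_power2[of "x + y"] by (simp add: power2_eq_square algebra_simps)
  ultimately have "(w - p)\<^sup>2 \<le> 2 * ?N\<^sup>2 + 2 * (q * (1 - 2 * s * w))\<^sup>2" by simp
  also have "\<dots> \<le> 16 * (q * M)"
  proof -
    have "0 < q * M" using A M by simp
    then show ?thesis using 1 2 by linarith
  qed
  finally show ?thesis by simp
qed

lemma ln_halfcos_le:
  assumes "s \<in> {-1, 0, 1}" "0 < p" "p \<le> M" "M \<le> 1 / 512"
  shows "\<bar>ln (halfcos s p)\<bar> \<le> M"
proof -
  have sp: "\<bar>s * p\<bar> \<le> p" using assms by auto
  have "ln (halfcos s p) = ln (1 + - (s * p)) / 2" unfolding halfcos_def using sp assms by (subst ln_sqrt) auto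
  moreover have "\<bar>ln (1 + - (s * p))\<bar> \<le> 2 * \<bar>- (s * p)\<bar>" using sp assms by (intro abs_ln_one_plus_le) auto
  ultimately show ?thesis using sp assms by simp
qed

text \<open>
  The midline is half of the opposite side up to a relative error \<open>O(M)\<close>, however short that side may
  be compared with the other two. The delicate term is the square of
  \<open>(w - p) / (halfcos s p + halfcos s w)\<close>, which \<open>side_difference\<close> bounds by a multiple of \<open>q * M\<close>.
\<close>

lemma midline_estimates:
  assumes "admissible s p q w" "p \<le> M" "q \<le> M" "w \<le> M" "M \<le> 1 / 512"
  shows "0 < midline s q p w" "midline s q p w \<le> M / 2"
    "\<bar>ln (gsin s (midline s q p w)) - ln (sqrt q)\<bar> \<le> 11 * M"
proof -
  note A = assms(1)[unfolded admissible_def]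
  have M: "0 < M" using A assms by linarith
  define a c where "a = halfcos s p" and "c = halfcos s w"
  have m: "a > 0" "a\<^sup>2 = 1 - s * p" "c > 0" "c\<^sup>2 = 1 - s * w"
    using A halfcos_pos halfcos_sq by (auto simp: a_def c_def)
  have lna: "\<bar>ln a\<bar> \<le> M" and lnc: "\<bar>ln c\<bar> \<le> M"
    using A assms ln_halfcos_le by (auto simp: a_def c_def)
  then have a1: "\<bar>a - 1\<bar> \<le> 2 * M" and c1: "\<bar>c - 1\<bar> \<le> 2 * M"
    using m assms by (auto intro!: abs_minus_one_le_ln)
  define \<theta> where "\<theta> = ((w - p) / (a + c))\<^sup>2 / q"
  have "(a + c)\<^sup>2 \<ge> (2 - 4 * M)\<^sup>2" using a1 c1 assms by (intro power_mono) auto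
  also have "(2 - 4 * M)\<^sup>2 \<ge> (2 - 4 * (1/512))\<^sup>2" using assms by (intro power_mono) auto
  finally have ac: "(a + c)\<^sup>2 \<ge> 2" by (simp add: power2_eq_square)
  have th: "0 \<le> \<theta>" "\<theta> \<le> 8 * M"
  proof -
    show "0 \<le> \<theta>" using A by (simp add: \<theta>_def)
    have "(w - p)\<^sup>2 / (a + c)\<^sup>2 \<le> 16 * q * M / 2"
      using side_difference[OF assms] ac A M by (intro frac_le) auto
    then have "(w - p)\<^sup>2 / (a + c)\<^sup>2 / q \<le> 16 * q * M / 2 / q"
      using A by (intro divide_right_mono) auto
    then show "\<theta> \<le> 8 * M" using A by (simp add: \<theta>_def power_divide)
  qed
  have q': "midline s q p w = q * (1 + - (s * \<theta>)) / (4 * (a * c))"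
    using A by (simp add: midline_def \<theta>_def a_def c_def algebra_simps)
  have st: "\<bar>s * \<theta>\<bar> \<le> 8 * M" using A th by auto
  have mq: "(1 - 2 * M) * (1 - 2 * M) \<le> a * c" using a1 c1 assms by (intro mult_mono) auto
  moreover have "(1 - 2 * (1/512)) * (1 - 2 * (1/512)) \<le> (1 - 2 * M) * (1 - 2 * M)"
    using assms by (intro mult_mono) auto
  ultimately have ac2: "a * c \<ge> 3/4" by simp
  show q0: "0 < midline s q p w" unfolding q' using A m st assms by auto
  have "midline s q p w \<le> M * (1 + 1/64) / (4 * (3/4))"
    unfolding q' using A m st assms ac2 by (intro frac_le mult_mono) auto
  also have "\<dots> \<le> M / 2" using M by simp
  finally show q2: "midline s q p w \<le> M / 2" .
  have sq: "\<bar>s * midline s q p w\<bar> \<le> M / 2" using A q0 q2 by auto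
  have "(gsin s (midline s q p w)) = sqrt (q * (1 + - (s * \<theta>)) * (1 + - (s * midline s q p w)) / (a * c))"
    (is "_ = sqrt ?r")
  proof -
    have "?r = 4 * (midline s q p w * (1 - s * midline s q p w))" unfolding q' using m by (simp add: field_simps)
    then show ?thesis unfolding gsin_def by (simp add: real_sqrt_mult)
  qed
  moreover have "?r > 0" using A m st sq assms by (intro divide_pos_pos mult_pos_pos) auto
  moreover have "ln ?r = ln q + ln (1 + - (s * \<theta>)) + ln (1 + - (s * midline s q p w)) - ln a - ln c"
  proof -
    have "1 + - (s * \<theta>) > 0" "1 + - (s * midline s q p w) > 0" "q > 0" using A st sq assms by auto
    then show ?thesis using m by (simp add: ln_div ln_mult del: add_uminus_conv_diff)
  qed
  ultimately have "ln (gsin s (midline s q p w)) =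
     (ln q + ln (1 + - (s * \<theta>)) + ln (1 + - (s * midline s q p w)) - ln a - ln c) / 2"
    by (simp add: ln_sqrt)
  moreover have "ln (sqrt q) = ln q / 2" using A by (simp add: ln_sqrt)
  moreover have "\<bar>ln (1 + - (s * \<theta>))\<bar> \<le> 2 * \<bar>- (s * \<theta>)\<bar>" using st assms by (intro abs_ln_one_plus_le) auto
  moreover have "\<bar>ln (1 + - (s * midline s q p w))\<bar> \<le> 2 * \<bar>- (s * midline s q p w)\<bar>"
    using sq assms by (intro abs_ln_one_plus_le) auto
  ultimately show "\<bar>ln (gsin s (midline s q p w)) - ln (sqrt q)\<bar> \<le> 11 * M"
    using lna lnc st sq by (simp del: add_uminus_conv_diff)
qed

text \<open>
  The quantity \<open>e\<close> is the cosine of the angle in the Euclidean triangle whose sides are the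
  square roots of \<open>p\<close>, \<open>q\<close>, \<open>w\<close>. On the sphere and in the plane this triangle exists and
  \<open>\<bar>e\<bar> \<le> 1\<close>; in the hyperbolic plane \<open>\<bar>e\<bar>\<close> can exceed \<open>1\<close> slightly.
\<close>

lemma flat_cosine_estimate:
  assumes "admissible s p q w" "p \<le> M" "q \<le> M" "w \<le> M" "M \<le> 1 / 512"
  defines "e \<equiv> (q + w - p) / (2 * (sqrt q * sqrt w))"
  shows "\<bar>e\<bar> \<le> 2" "\<bar>e - cos (ang s p q w)\<bar> \<le> 2 * M"
proof -
  note A = assms(1)[unfolded admissible_def]
  have M: "0 < M" using A assms by linarith
  define b c where "b = halfcos s q" and "c = halfcos s w"
  have m: "b > 0" "b\<^sup>2 = 1 - s * q" "c > 0" "c\<^sup>2 = 1 - s * w"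
    using A halfcos_pos halfcos_sq by (auto simp: b_def c_def)
  have sq: "sqrt q > 0" "sqrt w > 0" using A by auto
  have "cos (ang s p q w) * (b * c) = 2 * gprod s p q w / (4 * (sqrt q * sqrt w))"
    using A m sq unfolding cos_sin_ang(1)[OF assms(1)] by (simp add: gsin_eq b_def c_def field_simps)
  also have "\<dots> = e - s * (q * w / (sqrt q * sqrt w))"
    using sq by (simp add: e_def gprod_def field_simps)
  also have "q * w / (sqrt q * sqrt w) = sqrt q * sqrt w"
    using A by (simp add: field_simps)
  finally have e: "e = cos (ang s p q w) * (b * c) + s * (sqrt q * sqrt w)" by simp
  have "sqrt q * sqrt w \<le> sqrt M * sqrt M" using A assms by (intro mult_mono) auto
  then have "sqrt q * sqrt w \<le> M" using M by simp
  then have e2: "\<bar>s * (sqrt q * sqrt w)\<bar> \<le> M" using A sq M by auto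
  have bc: "\<bar>b * c - 1\<bar> \<le> M"
  proof -
    have "(b * c)\<^sup>2 = (1 - s * q) * (1 - s * w)" using m by (simp add: power_mult_distrib)
    moreover have "(1 - s * q) * (1 - s * w) \<le> (1 + M) * (1 + M)" using A assms by (intro mult_mono) auto
    moreover have "(1 - s * q) * (1 - s * w) \<ge> (1 - M) * (1 - M)" using A assms by (intro mult_mono) auto
    ultimately have "(b * c)\<^sup>2 \<le> (1 + M)\<^sup>2" "(1 - M)\<^sup>2 \<le> (b * c)\<^sup>2" by (auto simp: power2_eq_square)
    then have "b * c \<le> 1 + M" "1 - M \<le> b * c" using M m
      by (auto intro: power2_le_imp_le)
    then show ?thesis by simp
  qed
  have "e - cos (ang s p q w) = cos (ang s p q w) * (b * c - 1) + s * (sqrt q * sqrt w)"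
    unfolding e by (simp add: algebra_simps)
  moreover have "\<bar>cos (ang s p q w) * (b * c - 1)\<bar> \<le> 1 * M" unfolding abs_mult
    using bc by (intro mult_mono) auto
  ultimately show "\<bar>e - cos (ang s p q w)\<bar> \<le> 2 * M" using e2 by linarith
  then show "\<bar>e\<bar> \<le> 2" using abs_cos_le_one[of "ang s p q w"] assms(5) by linarith
qed

section \<open>The sides of the four children\<close>

text \<open>
  The triples of haversines of the inner triangle and of the outer triangles at \<open>A\<close>, \<open>B\<close>, \<open>C\<close>.
\<close>

definition child_sides :: "real \<Rightarrow> real \<Rightarrow> real \<Rightarrow> real \<Rightarrow> (real \<times> real \<times> real) set" where
  "child_sides s p q w =
     {(midline s p q w, midline s q p w, midline s w p q),
      (midline s p q w, half s q, half s w),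
      (half s p, midline s q p w, half s w),
      (half s p, half s q, midline s w p q)}"

text \<open>
  A positive Gram determinant forces the strict inequalities, since it is at most the product of the
  squared lengths of the two vectors, at each of the vertices.
\<close>

lemma gram_nonneg_imp_admissible:
  assumes "s \<in> {-1, 0, 1}" "0 \<le> p" "0 \<le> q" "0 \<le> w" "s * p \<le> 1" "s * q \<le> 1" "s * w \<le> 1"
    and "0 < gram s p q w"
  shows "admissible s p q w"
proof -
  have *: "0 < y \<and> s * y < 1 \<and> 0 < z \<and> s * z < 1"
    if "0 \<le> y" "0 \<le> z" "s * y \<le> 1" "s * z \<le> 1" "0 < gram s x y z" for x y z
  proof -
    have "0 < 4 * y * z * (1 - s * y) * (1 - s * z)"
      using that(5) zero_le_power2[of "gprod s x y z"] unfolding gram_def by linarith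
    then have "y \<noteq> 0" "z \<noteq> 0" "s * y \<noteq> 1" "s * z \<noteq> 1" by auto
    with that show ?thesis by (auto simp: less_le)
  qed
  show ?thesis
    using *[of q w p] *[of p w q] assms gram_swap(2)[of s p q w] by (auto simp: admissible_def)
qed

lemma gram_child_pos:
  assumes "admissible s p q w" "(p', q', w') \<in> child_sides s p q w"
  shows "0 < gram s p' q' w'"
proof -
  note A = assms(1)[unfolded admissible_def]
  have h: "0 < halfcos s p" "0 < halfcos s q" "0 < halfcos s w" using A halfcos_pos by auto
  have g: "gram s q p w = gram s p q w" "gram s p w q = gram s p q w" using gram_swap by metis+
  have "0 < gram s (midline s p q w) (midline s q p w) (midline s w p q)"
    unfolding inner_identities[OF assms(1)] using A h by simp
  moreover have "0 < gram s (midline s p q w) (half s q) (half s w)"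
    unfolding gram_swap(2)[of s "midline s p q w"]
    unfolding outer_identities[OF admissible_swap(2)[OF assms(1)]] using A h g by simp
  moreover have "0 < gram s (half s p) (midline s q p w) (half s w)"
    unfolding outer_identities[OF assms(1)] using A h by simp
  moreover have "0 < gram s (half s p) (half s q) (midline s w p q)"
    unfolding gram_swap(1)[of s "half s p" "half s q"]
    unfolding outer_identities[OF admissible_swap(1)[OF assms(1)]] using A h g by simp
  ultimately show ?thesis using assms(2) unfolding child_sides_def by auto
qed

section \<open>Change of the angle in one subdivision\<close>

lemma ang_corner:
  assumes "admissible s p q w" "admissible s (midline s p q w) (half s q) (half s w)"
  shows "ang s (midline s p q w) (half s q) (half s w) = ang s p q w"
proof -
  note A = assms(1)[unfolded admissible_def]
  have h: "0 < halfcos s q" "0 < halfcos s w" using A halfcos_pos by auto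
  have hp: "gsin s (half s q) = sqrt q" "gsin s (half s w) = sqrt w"
    using A by (simp_all add: half_props)
  have g: "gsin s q = 2 * (sqrt q * halfcos s q)" "gsin s w = 2 * (sqrt w * halfcos s w)"
    using A by (simp_all add: gsin_eq)
  have "2 * gprod s (midline s p q w) (half s q) (half s w) /
      (gsin s (half s q) * gsin s (half s w)) = 2 * gprod s p q w / (gsin s q * gsin s w)"
    unfolding outer_identities(3)[OF admissible_swap(2)[OF assms(1)]]
    unfolding hp g using A h by (simp add: field_simps)
  then show ?thesis by (simp add: ang_def)
qed

text \<open>
  With \<open>e\<close> the Euclidean cosine and \<open>k\<close> a factor close to \<open>1\<close>, the new angle has cosine \<open>k * e\<close>, and
  its sine is \<open>k * b\<close> times the old one, where \<open>b\<close> is again close to \<open>1\<close>.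
\<close>

lemma ang_outer:
  assumes "admissible s p q w" "p \<le> M" "q \<le> M" "w \<le> M" "M \<le> 1 / 512"
    and adm': "admissible s (half s p) (midline s q p w) (half s w)"
  shows "\<bar>ang s (half s p) (midline s q p w) (half s w) - ang s p q w\<bar> \<le> 512 * M * ang s p q w"
proof -
  note A = assms(1)[unfolded admissible_def]
  have M: "0 < M" using A assms by linarith
  define a b c where "a = halfcos s p" and "b = halfcos s q" and "c = halfcos s w"
  define g where "g = gsin s (midline s q p w)"
  define e where "e = (q + w - p) / (2 * (sqrt q * sqrt w))"
  define k where "k = sqrt q / (a * g)"
  have pos: "0 < a" "0 < b" "0 < c" "0 < g" "0 < sqrt q" "0 < sqrt w" "0 < k"
    using A adm'[unfolded admissible_def]
    by (auto simp: a_def b_def c_def g_def k_def halfcos_pos gsin_pos)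
  have lns: "\<bar>ln a\<bar> \<le> M" "\<bar>ln b\<bar> \<le> M" "\<bar>ln g - ln (sqrt q)\<bar> \<le> 11 * M"
    using A assms ln_halfcos_le midline_estimates[OF assms(1-5)] by (auto simp: a_def b_def g_def)
  have lnk: "ln k = ln (sqrt q) - ln a - ln g" unfolding k_def using pos by (simp add: ln_div ln_mult)
  have k1: "\<bar>k - 1\<bar> \<le> 2 * (12 * M)"
    using pos lns lnk assms(5) by (intro abs_minus_one_le_ln) auto
  have kb: "\<bar>k * b - 1\<bar> \<le> 2 * (13 * M)"
    using pos lns lnk assms(5) by (intro abs_minus_one_le_ln) (auto simp: ln_mult)
  have hw: "gsin s (half s w) = sqrt w" using A by (simp add: half_props)
  have cy: "cos (ang s (half s p) (midline s q p w) (half s w)) = k * e"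
    unfolding cos_sin_ang(1)[OF adm'] outer_identities(2)[OF assms(1)] g_def[symmetric]
      a_def[symmetric] hw
    using pos by (simp add: k_def e_def field_simps)
  have "sin (ang s (half s p) (midline s q p w) (half s w))
      = 2 * (sqrt (gram s p q w) / (4 * a * c)) / (g * sqrt w)"
    unfolding cos_sin_ang(2)[OF adm'] outer_identities(1)[OF assms(1)]
    using A pos by (simp add: real_sqrt_divide real_sqrt_mult half_props g_def a_def c_def)
  moreover have "sin (ang s p q w) = 2 * sqrt (gram s p q w) / (2 * (sqrt q * b) * (2 * (sqrt w * c)))"
    unfolding cos_sin_ang(2)[OF assms(1)] using A by (simp add: gsin_eq b_def c_def)
  moreover have "2 * (G / (4 * a * c)) / (g * sqrt w) =
      k * b * (2 * G / (2 * (sqrt q * b) * (2 * (sqrt w * c))))" for G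
    using pos by (simp add: k_def field_simps)
  ultimately have sy: "sin (ang s (half s p) (midline s q p w) (half s w)) = k * b * sin (ang s p q w)"
    by metis
  note e = flat_cosine_estimate[OF assms(1-5), folded e_def]
  have "\<bar>(k - 1) * e\<bar> \<le> 2 * (12 * M) * 2" unfolding abs_mult using k1 e M by (intro mult_mono) auto
  then have "\<bar>k * e - cos (ang s p q w)\<bar> \<le> 50 * M" using e by (simp add: algebra_simps)
  then have "\<bar>ang s (half s p) (midline s q p w) (half s w) - ang s p q w\<bar>
      \<le> 2 * (2 * (13 * M) + 50 * M) * ang s p q w"
    using assms(5) cos_sin_ang(3,4)[OF assms(1)] cos_sin_ang(3,4)[OF adm'] kb sy
    by (intro angle_compare) (simp_all add: cy)
  also have "\<dots> \<le> 512 * M * ang s p q w" using M cos_sin_ang(3)[OF assms(1)] by (intro mult_right_mono) auto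
  finally show ?thesis .
qed

text \<open>
  The same comparison as for the outer triangle, with a factor \<open>k\<close> for the sine and \<open>r\<close> for the
  cosine.
\<close>

lemma ang_inner:
  assumes "admissible s p q w" "p \<le> M" "q \<le> M" "w \<le> M" "M \<le> 1 / 512"
    and adm': "admissible s (midline s p q w) (midline s q p w) (midline s w p q)"
  shows "\<bar>ang s (midline s p q w) (midline s q p w) (midline s w p q) - ang s p q w\<bar>
     \<le> 512 * M * ang s p q w"
proof -
  note A = assms(1)[unfolded admissible_def]
  have M: "0 < M" using A assms by linarith
  define a b c where "a = halfcos s p" and "b = halfcos s q" and "c = halfcos s w"
  define g h where "g = gsin s (midline s q p w)" and "h = gsin s (midline s w p q)"
  define e where "e = (q + w - p) / (2 * (sqrt q * sqrt w))"
  define k where "k = sqrt q * sqrt w / (a * g * h)"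
  define \<sigma> where "\<sigma> = 1 - s * (p + q + w) / 2"
  define r where "r = k * \<sigma> / (a * b * c)"
  have "\<bar>s * (p + q + w) / 2\<bar> \<le> 3/2 * M" using A assms by auto
  then have t: "\<bar>- (s * (p + q + w) / 2)\<bar> \<le> 3/2 * M" by simp
  have \<sigma>0: "0 < \<sigma>" using t assms(5) by (simp add: \<sigma>_def)
  have ln\<sigma>: "\<bar>ln \<sigma>\<bar> \<le> 3 * M"
    using abs_ln_one_plus_le[of "- (s * (p + q + w) / 2)"] t assms(5) by (simp add: \<sigma>_def)
  have pos: "0 < a" "0 < b" "0 < c" "0 < g" "0 < h" "0 < sqrt q" "0 < sqrt w" "0 < k" "0 < r"
    using A adm'[unfolded admissible_def] \<sigma>0
    by (auto simp: a_def b_def c_def g_def h_def k_def r_def halfcos_pos gsin_pos)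
  have lns: "\<bar>ln a\<bar> \<le> M" "\<bar>ln b\<bar> \<le> M" "\<bar>ln c\<bar> \<le> M" "\<bar>ln g - ln (sqrt q)\<bar> \<le> 11 * M"
      "\<bar>ln h - ln (sqrt w)\<bar> \<le> 11 * M"
    using A assms ln_halfcos_le midline_estimates[OF assms(1-5)]
      midline_estimates[OF admissible_swap(1)[OF assms(1)] assms(2,4,3,5)]
    by (auto simp: a_def b_def c_def g_def h_def)
  have lnk: "ln k = ln (sqrt q) + ln (sqrt w) - ln a - ln g - ln h"
    unfolding k_def using pos by (simp add: ln_div ln_mult)
  have lnr: "ln r = ln k + ln \<sigma> - ln a - ln b - ln c"
    unfolding r_def using pos \<sigma>0 by (simp add: ln_div ln_mult)
  have k1: "\<bar>k - 1\<bar> \<le> 2 * (23 * M)"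
    using pos lns lnk assms(5) by (intro abs_minus_one_le_ln) auto
  have r1: "\<bar>r - 1\<bar> \<le> 2 * (29 * M)"
    using pos lns lnk lnr ln\<sigma> assms(5) by (intro abs_minus_one_le_ln) auto
  have cy: "cos (ang s (midline s p q w) (midline s q p w) (midline s w p q)) = r * e"
    unfolding cos_sin_ang(1)[OF adm'] inner_identities(2)[OF assms(1)] g_def[symmetric] h_def[symmetric]
      a_def[symmetric] b_def[symmetric] c_def[symmetric] \<sigma>_def[symmetric]
    using pos by (simp add: r_def k_def e_def field_simps power2_eq_square)
  have "sin (ang s (midline s p q w) (midline s q p w) (midline s w p q))
      = 2 * (sqrt (gram s p q w) / (4 * a * b * c)) / (g * h)"
    unfolding cos_sin_ang(2)[OF adm'] inner_identities(1)[OF assms(1)]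
    using A pos by (simp add: real_sqrt_divide real_sqrt_mult g_def h_def a_def b_def c_def)
  moreover have "sin (ang s p q w) = 2 * sqrt (gram s p q w) / (2 * (sqrt q * b) * (2 * (sqrt w * c)))"
    unfolding cos_sin_ang(2)[OF assms(1)] using A by (simp add: gsin_eq b_def c_def)
  moreover have "2 * (G / (4 * a * b * c)) / (g * h) =
      k * (2 * G / (2 * (sqrt q * b) * (2 * (sqrt w * c))))" for G
    using pos by (simp add: k_def field_simps)
  ultimately have sy: "sin (ang s (midline s p q w) (midline s q p w) (midline s w p q))
      = k * sin (ang s p q w)"
    by metis
  note e = flat_cosine_estimate[OF assms(1-5), folded e_def]
  have "\<bar>(r - 1) * e\<bar> \<le> 2 * (29 * M) * 2" unfolding abs_mult using r1 e M by (intro mult_mono) auto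
  then have "\<bar>r * e - cos (ang s p q w)\<bar> \<le> 118 * M" using e by (simp add: algebra_simps)
  then have "\<bar>ang s (midline s p q w) (midline s q p w) (midline s w p q) - ang s p q w\<bar>
      \<le> 2 * (2 * (23 * M) + 118 * M) * ang s p q w"
    using assms(5) cos_sin_ang(3,4)[OF assms(1)] cos_sin_ang(3,4)[OF adm'] k1 sy
    by (intro angle_compare) (simp_all add: cy)
  also have "\<dots> \<le> 512 * M * ang s p q w" using M cos_sin_ang(3)[OF assms(1)] by (intro mult_right_mono) auto
  finally show ?thesis .
qed

text \<open>
  The outer triangle at \<open>C\<close> is the mirror image of the one at \<open>B\<close> under exchanging \<open>b\<close> and \<open>c\<close>.
\<close>

lemma ang_step:
  assumes "admissible s p q w" "p \<le> M" "q \<le> M" "w \<le> M" "M \<le> 1 / 512"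
    and "(p', q', w') \<in> child_sides s p q w" "admissible s p' q' w'"
  shows "\<bar>ang s p' q' w' - ang s p q w\<bar> \<le> 512 * M * ang s p q w"
proof -
  have M: "0 < M" using assms(1,2) by (simp add: admissible_def)
  consider "(p', q', w') = (midline s p q w, midline s q p w, midline s w p q)"
    | "(p', q', w') = (midline s p q w, half s q, half s w)"
    | "(p', q', w') = (half s p, midline s q p w, half s w)"
    | "(p', q', w') = (half s p, half s q, midline s w p q)"
    using assms(6) by (auto simp: child_sides_def)
  then show ?thesis
  proof cases
    case 1
    then show ?thesis using ang_inner[OF assms(1-5)] assms(7) by simp
  next
    case 2
    then show ?thesis using ang_corner[OF assms(1)] assms(7) M cos_sin_ang(3)[OF assms(1)] by simp
  next
    case 3
    then show ?thesis using ang_outer[OF assms(1-5)] assms(7) by simp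
  next
    case 4
    then show ?thesis
      using ang_outer[OF admissible_swap(1)[OF assms(1)] assms(2,4,3,5)] admissible_swap(1)[OF assms(7)]
      by (simp add: ang_swap[of s "half s p" "half s q"] ang_swap[of s p q])
  qed
qed

section \<open>Accumulated change of the angle\<close>

text \<open>
  The two signs of curvature need different reasons. For \<open>s = 1\<close> the square is
  subtracted, but the denominator may be small, whence the bound on \<open>M\<close>. For \<open>s = - 1\<close> the
  denominator is at least \<open>4\<close> and the square \<open>d\<close> adds at most \<open>M\<close> to the numerator,
  whatever the size of the triangle.
\<close>

lemma midline_le_half:
  assumes "s \<in> {-1, 0, 1}" "0 < p" "0 < q" "0 < w" "s * p < 1" "s * w < 1"
    and "p \<le> M" "q \<le> M" "w \<le> M" "s = 1 \<Longrightarrow> M \<le> 1 / 2"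
  shows "midline s q p w \<le> M / 2"
proof -
  define a c where "a = halfcos s p" and "c = halfcos s w"
  have m: "a > 0" "a\<^sup>2 = 1 - s * p" "c > 0" "c\<^sup>2 = 1 - s * w"
    unfolding a_def c_def using assms(5,6) by (simp_all only: halfcos_pos halfcos_sq)
  define d where "d = ((w - p) / (a + c))\<^sup>2"
  have ml: "midline s q p w = (q - s * d) / (4 * a * c)" by (simp add: midline_def a_def c_def d_def)
  show ?thesis
  proof (cases "s = 1")
    case True
    have "(1/2)\<^sup>2 \<le> (a * c)\<^sup>2"
    proof -
      have "(1/2) * (1/2) \<le> (1 - s * p) * (1 - s * w)"
        using True assms by (intro mult_mono) auto
      then have "(1/2)\<^sup>2 \<le> (1 - s * p) * (1 - s * w)" by (simp add: power2_eq_square)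
      then show ?thesis by (simp only: m power_mult_distrib)
    qed
    then have ac: "1/2 \<le> a * c" by (rule power2_le_imp_le) (use m(1,3) in simp)
    have "0 \<le> d" by (simp add: d_def)
    then have "q - s * d \<le> M" using True assms(8) by simp
    then have "midline s q p w \<le> M / (4 * (1/2))"
      unfolding ml using assms(3,8) ac m(1,3) by (intro frac_le) auto
    then show ?thesis by simp
  next
    case False
    then have s: "s = 0 \<or> s = -1" using assms by auto
    have ac: "1 \<le> a" "1 \<le> c" using s assms by (auto simp: a_def c_def halfcos_def)
    have "d \<le> M \<or> s = 0"
    proof (cases "s = 0")
      case False
      have "\<bar>w - p\<bar> \<le> a\<^sup>2 + c\<^sup>2" unfolding m(2,4) using s False assms(2-4) by auto
      also have "\<dots> \<le> (a + c)\<^sup>2" using m(1,3) by (simp add: power2_sum)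
      finally have wp: "\<bar>w - p\<bar> \<le> (a + c)\<^sup>2" .
      have "\<bar>w - p\<bar> * \<bar>w - p\<bar> \<le> (a + c)\<^sup>2 * M"
        using wp assms by (intro mult_mono) auto
      then have "(w - p)\<^sup>2 \<le> M * (a + c)\<^sup>2" by (simp add: power2_eq_square mult.commute)
      then have "d \<le> M" using m(1,3) by (simp add: d_def power_divide field_simps)
      then show ?thesis ..
    qed simp
    then have num: "q - s * d \<le> 2 * M" using s assms by auto
    have "1 * 1 \<le> a * c" using ac by (intro mult_mono) auto
    then have "midline s q p w \<le> 2 * M / (4 * 1)"
      unfolding ml using num assms by (intro frac_le) auto
    then show ?thesis by simp
  qed
qed

lemma child_sides_le_half:
  assumes "admissible s p q w" "p \<le> M" "q \<le> M" "w \<le> M" "s = 1 \<Longrightarrow> M \<le> 1 / 2"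
    and "(p', q', w') \<in> child_sides s p q w"
  shows "p' \<le> M / 2" "q' \<le> M / 2" "w' \<le> M / 2"
proof -
  note A = assms(1)[unfolded admissible_def]
  have mid: "midline s y x z \<le> M / 2"
    if "0 < x" "0 < y" "0 < z" "s * x < 1" "s * z < 1" "x \<le> M" "y \<le> M" "z \<le> M" for x y z
    using that A assms(5) by (intro midline_le_half) auto
  have "half s p \<le> M / 2" "half s q \<le> M / 2" "half s w \<le> M / 2"
    using A assms half_props(5)[of p s] half_props(5)[of q s] half_props(5)[of w s] by auto
  moreover have "midline s p q w \<le> M / 2" "midline s q p w \<le> M / 2" "midline s w p q \<le> M / 2"
    using mid A assms(2-4) by auto
  ultimately show "p' \<le> M / 2" "q' \<le> M / 2" "w' \<le> M / 2"
    using assms(6) unfolding child_sides_def by auto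
qed

text \<open>
  Relative errors that decay geometrically add up to a relative error of the order of the first one.
  The partial sums \<open>1 - 1 / 2 ^ n\<close> are kept so that the induction closes; they first give
  \<open>\<alpha> n \<le> 2 * \<alpha> 0\<close>, which turns the errors relative to \<open>\<alpha> n\<close> into errors relative to \<open>\<alpha> 0\<close>.
\<close>

lemma geometric_drift:
  fixes \<alpha> :: "nat \<Rightarrow> real"
  assumes "\<And>n. 0 < \<alpha> n" "0 \<le> K" "4 * K \<le> 1"
    and "\<And>n. \<bar>\<alpha> (Suc n) - \<alpha> n\<bar> \<le> K / 2 ^ n * \<alpha> n"
  shows "\<bar>\<alpha> n - \<alpha> 0\<bar> \<le> 4 * K * \<alpha> 0 * (1 - 1 / 2 ^ n)"
proof (induction n)
  case (Suc n)
  have "4 * K * \<alpha> 0 * (1 - 1 / 2 ^ n) \<le> 1 * \<alpha> 0 * 1"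
    using assms(1)[of 0] assms(2,3) by (intro mult_mono) auto
  then have "\<alpha> n \<le> 2 * \<alpha> 0" using Suc by linarith
  then have "K / 2 ^ n * \<alpha> n \<le> K / 2 ^ n * (2 * \<alpha> 0)" using assms(2) by (intro mult_left_mono) auto
  then have "\<bar>\<alpha> (Suc n) - \<alpha> 0\<bar> \<le> 4 * K * \<alpha> 0 * (1 - 1 / 2 ^ n) + K / 2 ^ n * (2 * \<alpha> 0)"
    using Suc assms(4)[of n] by linarith
  also have "\<dots> = 4 * K * \<alpha> 0 * (1 - 1 / 2 ^ Suc n)" by (simp add: field_simps)
  finally show ?case .
qed simp

lemma eventual_bounds_imp_bounds:
  fixes \<alpha> :: "nat \<Rightarrow> real"
  assumes pos: "\<And>n. 0 < \<alpha> n" and tail: "\<And>n. \<bar>\<alpha> (N + n) - \<alpha> N\<bar> \<le> \<alpha> N / 2"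
  shows "\<exists>l L. 0 < l \<and> 0 < L \<and> (\<forall>n. \<alpha> 0 * l < \<alpha> n \<and> \<alpha> n < \<alpha> 0 * L)"
proof -
  define m U where "m = Min (\<alpha> ` {..N})" and "U = Max (\<alpha> ` {..N})"
  have mU: "m \<le> \<alpha> n" "\<alpha> n \<le> U" if "n \<le> N" for n using that by (auto simp: m_def U_def)
  have m0: "0 < m" using pos by (auto simp: m_def)
  have U0: "0 < U" using mU(2)[of 0] pos[of 0] by simp
  have b: "m / 4 < \<alpha> n \<and> \<alpha> n < 4 * U" for n
  proof (cases "n \<le> N")
    case True
    then show ?thesis using mU[of n] m0 U0 by auto
  next
    case False
    then obtain k where "n = N + k" using le_Suc_ex nat_le_linear by blast
    then show ?thesis using tail[of k] mU[of N] m0 U0 by (simp only: abs_le_iff) linarith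
  qed
  have "0 < m / 4 / \<alpha> 0" "0 < 4 * U / \<alpha> 0" using m0 U0 pos[of 0] by auto
  moreover have "\<alpha> 0 * (m / 4 / \<alpha> 0) = m / 4" "\<alpha> 0 * (4 * U / \<alpha> 0) = 4 * U" using pos[of 0] by auto
  ultimately show ?thesis using b by metis
qed

lemma tail_drift:
  assumes adm: "\<And>n. admissible s (p n) (q n) (w n)"
    and child: "\<And>n. (p (Suc n), q (Suc n), w (Suc n)) \<in> child_sides s (p n) (q n) (w n)"
    and "p 0 \<le> M" "q 0 \<le> M" "w 0 \<le> M" "M \<le> 1 / 2048"
  shows "\<bar>ang s (p n) (q n) (w n) - ang s (p 0) (q 0) (w 0)\<bar> \<le> 2048 * M * ang s (p 0) (q 0) (w 0)"
proof -
  have M: "0 < M" using adm[of 0] assms(3) by (simp add: admissible_def)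
  have Mn: "M / 2 ^ n \<le> 1 / 2048" for n
  proof -
    have "M / 2 ^ n \<le> M / 1" using M by (intro divide_left_mono) auto
    then show ?thesis using assms(6) by linarith
  qed
  \<comment> \<open>Each subdivision halves the bound on the haversines.\<close>
  have size: "p n \<le> M / 2 ^ n \<and> q n \<le> M / 2 ^ n \<and> w n \<le> M / 2 ^ n" for n
  proof (induction n)
    case (Suc n)
    then have S: "p n \<le> M / 2 ^ n" "q n \<le> M / 2 ^ n" "w n \<le> M / 2 ^ n" by auto
    have "M / 2 ^ n \<le> 1 / 2" using Mn[of n] by linarith
    from child_sides_le_half[OF adm S this child] show ?case by (simp add: mult.commute)
  qed (use assms in auto)
  have step: "\<bar>ang s (p (Suc n)) (q (Suc n)) (w (Suc n)) - ang s (p n) (q n) (w n)\<bar>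
      \<le> 512 * M / 2 ^ n * ang s (p n) (q n) (w n)" for n
  proof -
    have "M / 2 ^ n \<le> 1 / 512" using Mn[of n] by linarith
    then show ?thesis
      using ang_step[OF adm, of n "M / 2 ^ n", OF _ _ _ _ child adm] size[of n] by simp
  qed
  have "\<bar>ang s (p n) (q n) (w n) - ang s (p 0) (q 0) (w 0)\<bar>
      \<le> 4 * (512 * M) * ang s (p 0) (q 0) (w 0) * (1 - 1 / 2 ^ n)"
    by (rule geometric_drift) (use M assms(6) step cos_sin_ang(3)[OF adm] in auto)
  also have "\<dots> \<le> 4 * (512 * M) * ang s (p 0) (q 0) (w 0) * 1"
    using M cos_sin_ang(3)[OF adm, of 0] by (intro mult_left_mono) auto
  finally show ?thesis by simp
qed

section \<open>The model surfaces\<close>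

lemma model_form_commute: "model_form \<kappa> x y = model_form \<kappa> y x"
  by (simp add: model_form_def algebra_simps)

lemma model_form_linear:
  "model_form \<kappa> (x + y) z = model_form \<kappa> x z + model_form \<kappa> y z"
  "model_form \<kappa> (x - y) z = model_form \<kappa> x z - model_form \<kappa> y z"
  "model_form \<kappa> (r *\<^sub>R x) z = r * model_form \<kappa> x z"
  "model_form \<kappa> z (x + y) = model_form \<kappa> z x + model_form \<kappa> z y"
  "model_form \<kappa> z (x - y) = model_form \<kappa> z x - model_form \<kappa> z y"
  "model_form \<kappa> z (r *\<^sub>R x) = r * model_form \<kappa> z x"
  by (simp_all add: model_form_def algebra_simps)

text \<open>
  Defined from the chord between the two points, which makes sense in all three models and gives
  \<open>sin\<^sup>2\<close>, \<open>sinh\<^sup>2\<close> or the square of half the rescaled distance.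
\<close>

definition hav :: "real \<Rightarrow> real^3 \<Rightarrow> real^3 \<Rightarrow> real" where
  "hav \<kappa> x y = model_form \<kappa> (x - y) (x - y) / 4"

lemma hav_self [simp]: "hav \<kappa> x x = 0" by (simp add: hav_def model_form_def)

lemma hav_commute: "hav \<kappa> x y = hav \<kappa> y x"
  by (simp add: hav_def model_form_linear)

lemma model_form_self:
  "\<kappa> \<noteq> 0 \<Longrightarrow> x \<in> model_space \<kappa> \<Longrightarrow> model_form \<kappa> x x = sgn \<kappa>"
  by (auto simp: model_space_def split: if_splits)

lemma model_form_hav:
  assumes "\<kappa> \<noteq> 0" "x \<in> model_space \<kappa>" "y \<in> model_space \<kappa>"
  shows "model_form \<kappa> x y = sgn \<kappa> - 2 * hav \<kappa> x y"
  using assms by (simp add: hav_def model_form_linear model_form_self model_form_commute[of _ y x] field_simps)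

lemma model_space_flat: "x \<in> model_space 0 \<longleftrightarrow> x $ 3 = 1"
  by (simp add: model_space_def)

definition tangent :: "real \<Rightarrow> real^3 \<Rightarrow> real^3 \<Rightarrow> bool" where
  "tangent \<kappa> p u \<longleftrightarrow> (if \<kappa> = 0 then u $ 3 = 0 else model_form \<kappa> p u = 0)"

lemma unit_tangent_iff: "u \<in> unit_tangent \<kappa> p \<longleftrightarrow> tangent \<kappa> p u \<and> model_form \<kappa> u u = 1"
  by (simp add: unit_tangent_def tangent_def)

lemma tangent_linear:
  "tangent \<kappa> p u \<Longrightarrow> tangent \<kappa> p (r *\<^sub>R u)"
  "tangent \<kappa> p u \<Longrightarrow> tangent \<kappa> p v \<Longrightarrow> tangent \<kappa> p (u - v)"
  by (auto simp: tangent_def model_form_linear split: if_splits)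

lemma cauchy2: "((a::real) * c + b * d)\<^sup>2 \<le> (a\<^sup>2 + b\<^sup>2) * (c\<^sup>2 + d\<^sup>2)"
proof -
  have "(a\<^sup>2 + b\<^sup>2) * (c\<^sup>2 + d\<^sup>2) - (a * c + b * d)\<^sup>2 = (a * d - b * c)\<^sup>2" by algebra
  then show ?thesis by (smt (verit) zero_le_power2)
qed

text \<open>
  In the hyperbolic case this is the reversed Cauchy-Schwarz inequality: a nonzero vector orthogonal to a
  timelike one is spacelike.
\<close>

lemma tangent_form_pos:
  assumes "p \<in> model_space \<kappa>" "tangent \<kappa> p v" "v \<noteq> 0"
  shows "model_form \<kappa> v v > 0"
proof -
  have v: "v $ 1 \<noteq> 0 \<or> v $ 2 \<noteq> 0 \<or> v $ 3 \<noteq> 0"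
    using assms(3) by (auto simp: vec_eq_iff forall_3)
  consider "\<kappa> = 0" | "\<kappa> > 0" | "\<kappa> < 0" by linarith
  then show ?thesis
  proof cases
    case 1
    then have "v $ 3 = 0" using assms by (simp add: tangent_def)
    then show ?thesis using v 1 unfolding model_form_def
      by (auto simp: sum_squares_gt_zero_iff)
  next
    case 2
    have "(v$1)\<^sup>2 + (v$2)\<^sup>2 + (v$3)\<^sup>2 > 0" using v
      by (smt (verit) zero_le_power2 zero_less_power2)
    then show ?thesis using 2 by (simp add: model_form_def power2_eq_square)
  next
    case 3
    have p: "(p$3)\<^sup>2 = 1 + (p$1)\<^sup>2 + (p$2)\<^sup>2" and p3: "p$3 > 0"
      using assms(1) 3 by (auto simp: model_space_def model_form_def power2_eq_square)
    have t: "p$1 * v$1 + p$2 * v$2 = p$3 * v$3"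
      using assms(2) 3 by (auto simp: tangent_def model_form_def)
    have "(p$3)\<^sup>2 * (v$3)\<^sup>2 \<le> ((p$3)\<^sup>2 - 1) * ((v$1)\<^sup>2 + (v$2)\<^sup>2)"
      using cauchy2[of "p$1" "v$1" "p$2" "v$2"] unfolding t p by (simp add: power_mult_distrib p)
    moreover have nz: "(v$1)\<^sup>2 + (v$2)\<^sup>2 > 0"
    proof (rule ccontr)
      assume "\<not> ?thesis"
      then have "v$1 = 0" "v$2 = 0" by (auto simp: not_less sum_power2_le_zero_iff)
      then show False using t p3 v by simp
    qed
    ultimately have "(p$3)\<^sup>2 * (v$3)\<^sup>2 < (p$3)\<^sup>2 * ((v$1)\<^sup>2 + (v$2)\<^sup>2)"
      by (simp add: algebra_simps)
    then have "(v$3)\<^sup>2 < (v$1)\<^sup>2 + (v$2)\<^sup>2" using p3 by simp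
    then show ?thesis using 3 by (simp add: model_form_def power2_eq_square)
  qed
qed

lemma tangent_form_nonneg:
  assumes "p \<in> model_space \<kappa>" "tangent \<kappa> p v"
  shows "model_form \<kappa> v v \<ge> 0"
  using tangent_form_pos[OF assms] by (cases "v = 0") (auto simp: model_form_def)

text \<open>
  The tangential part of \<open>x\<close> at \<open>p\<close>. For \<open>\<kappa> \<noteq> 0\<close> the coefficient is the normalised inner product of
  \<open>p\<close> and \<open>x\<close>; for \<open>\<kappa> = 0\<close> it is \<open>1\<close>, so that the difference vector \<open>x - p\<close> results.
\<close>

definition tproj :: "real \<Rightarrow> real^3 \<Rightarrow> real^3 \<Rightarrow> real^3" where
  "tproj \<kappa> p x = x - (1 - 2 * sgn \<kappa> * hav \<kappa> p x) *\<^sub>R p"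

lemma sgn_mult_self: "\<kappa> \<noteq> 0 \<Longrightarrow> sgn \<kappa> * sgn \<kappa> = (1::real)"
  by (simp add: sgn_if)

lemma tproj_tangent:
  assumes "p \<in> model_space \<kappa>" "x \<in> model_space \<kappa>"
  shows "tangent \<kappa> p (tproj \<kappa> p x)"
proof (cases "\<kappa> = 0")
  case True
  then show ?thesis using assms by (simp add: tangent_def tproj_def model_space_flat)
next
  case False
  then show ?thesis using assms
    by (simp add: tangent_def tproj_def model_form_linear model_form_hav model_form_self algebra_simps
      sgn_mult_self sgn_if)
qed

lemma tproj_form:
  assumes "p \<in> model_space \<kappa>" "x \<in> model_space \<kappa>" "y \<in> model_space \<kappa>"
  shows "model_form \<kappa> (tproj \<kappa> p x) (tproj \<kappa> p y) =
     2 * (hav \<kappa> p x + hav \<kappa> p y - hav \<kappa> x y - 2 * sgn \<kappa> * hav \<kappa> p x * hav \<kappa> p y)"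
proof (cases "\<kappa> = 0")
  case True
  then show ?thesis by (simp add: tproj_def hav_def model_form_def field_simps)
next
  case False
  have "model_form \<kappa> (tproj \<kappa> p x) (tproj \<kappa> p y) =
     (sgn \<kappa> - 2 * hav \<kappa> x y) - (1 - 2 * sgn \<kappa> * hav \<kappa> p y) * (sgn \<kappa> - 2 * hav \<kappa> p x)
      - (1 - 2 * sgn \<kappa> * hav \<kappa> p x) * (sgn \<kappa> - 2 * hav \<kappa> p y)
      + (1 - 2 * sgn \<kappa> * hav \<kappa> p x) * (1 - 2 * sgn \<kappa> * hav \<kappa> p y) * sgn \<kappa>"
    using assms False
    by (simp add: tproj_def model_form_linear model_form_hav model_form_self hav_commute[of \<kappa> x p]
       hav_commute[of \<kappa> y p] algebra_simps)
  then show ?thesis using False by (cases "\<kappa> > 0") (simp_all add: algebra_simps)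
qed

lemma tproj_form_self:
  assumes "p \<in> model_space \<kappa>" "x \<in> model_space \<kappa>"
  shows "model_form \<kappa> (tproj \<kappa> p x) (tproj \<kappa> p x) = 4 * (hav \<kappa> p x * (1 - sgn \<kappa> * hav \<kappa> p x))"
  using tproj_form[OF assms assms(2)] by (simp add: algebra_simps)

text \<open>
  The squared length of the tangential part is \<open>4 h (1 - s h)\<close>, and being nonnegative it
  yields both bounds, except that for \<open>\<kappa> < 0\<close> the branch \<open>h \<le> - 1\<close> has to be excluded: there the two
  points would lie on different sheets of the hyperboloid.
\<close>

lemma hav_bounds:
  assumes "x \<in> model_space \<kappa>" "y \<in> model_space \<kappa>"
  shows "hav \<kappa> x y \<ge> 0" "sgn \<kappa> * hav \<kappa> x y \<le> 1"
proof -
  have *: "hav \<kappa> x y * (1 - sgn \<kappa> * hav \<kappa> x y) \<ge> 0"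
    using tangent_form_nonneg[OF assms(1) tproj_tangent[OF assms]] tproj_form_self[OF assms] by simp
  have "hav \<kappa> x y \<ge> 0 \<and> sgn \<kappa> * hav \<kappa> x y \<le> 1"
  proof -
    consider "\<kappa> = 0" | "\<kappa> > 0" | "\<kappa> < 0" by linarith
    then show ?thesis
    proof cases
      case 1
      then show ?thesis using * by simp
    next
      case 2
      then show ?thesis using * by (auto simp: zero_le_mult_iff)
    next
      case 3
      have x: "(x$3)\<^sup>2 = 1 + ((x$1)\<^sup>2 + (x$2)\<^sup>2)" "x$3 > 0" and y: "(y$3)\<^sup>2 = 1 + ((y$1)\<^sup>2 + (y$2)\<^sup>2)" "y$3 > 0"
        using assms 3 by (auto simp: model_space_def model_form_def power2_eq_square)
      have "(x$1 * y$1 + x$2 * y$2)\<^sup>2 \<le> ((x$1)\<^sup>2 + (x$2)\<^sup>2) * ((y$1)\<^sup>2 + (y$2)\<^sup>2)"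
        by (rule cauchy2)
      also have "\<dots> \<le> (x$3)\<^sup>2 * (y$3)\<^sup>2" unfolding x(1) y(1) by (intro mult_mono) auto
      finally have "x$1 * y$1 + x$2 * y$2 \<le> x$3 * y$3"
        using x(2) y(2) by (metis less_eq_real_def mult_pos_pos power2_le_imp_le power_mult_distrib)
      then have "model_form \<kappa> x y \<le> 0" using 3 by (simp add: model_form_def)
      then have "hav \<kappa> x y \<ge> - 1/2" using model_form_hav[of \<kappa> x y] assms 3 by simp
      then have "0 < 1 - sgn \<kappa> * hav \<kappa> x y" using 3 by simp
      then show ?thesis using * by (auto simp: zero_le_mult_iff)
    qed
  qed
  then show "hav \<kappa> x y \<ge> 0" "sgn \<kappa> * hav \<kappa> x y \<le> 1" by auto
qed

lemma model_dist_flat: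
  "x \<in> model_space 0 \<Longrightarrow> y \<in> model_space 0 \<Longrightarrow> model_dist 0 x y = 2 * sqrt (hav 0 x y)"
  by (simp add: model_dist_def dist_norm norm_eq_sqrt_inner inner_vec_def sum_3 hav_def
    model_form_def model_space_flat real_sqrt_divide)

lemma geod_at_dist:
  assumes "p \<in> model_space \<kappa>" "q \<in> model_space \<kappa>"
  shows "geod \<kappa> p u (model_dist \<kappa> p q) =
    (1 - 2 * sgn \<kappa> * hav \<kappa> p q) *\<^sub>R p + gsin (sgn \<kappa>) (hav \<kappa> p q) *\<^sub>R u"
proof -
  let ?h = "hav \<kappa> p q"
  note b = hav_bounds[OF assms]
  consider "\<kappa> = 0" | "\<kappa> > 0" | "\<kappa> < 0" by linarith
  then show ?thesis
  proof cases
    case 1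
    then show ?thesis using model_dist_flat[of p q] assms by (simp add: geod_def gsin_def)
  next
    case 2
    have f: "model_form \<kappa> p q = 1 - 2 * ?h" using model_form_hav[of \<kappa> p q] 2 assms by simp
    have r: "- 1 \<le> 1 - 2 * ?h" "1 - 2 * ?h \<le> 1" using b 2 by auto
    have "1 - (1 - 2 * ?h)\<^sup>2 = 2\<^sup>2 * (?h * (1 - ?h))" by algebra
    then have "sqrt (1 - (1 - 2 * ?h)\<^sup>2) = 2 * sqrt (?h * (1 - ?h))"
      by (simp only: real_sqrt_mult real_sqrt_abs)
    then show ?thesis using 2 r by (simp add: geod_def model_dist_def gsin_def f sin_arccos)
  next
    case 3
    have f: "- model_form \<kappa> p q = 1 + 2 * ?h" using model_form_hav[of \<kappa> p q] 3 assms by simp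
    have r: "1 \<le> 1 + 2 * ?h" using b 3 by auto
    have "(1 + 2 * ?h)\<^sup>2 - 1 = 2\<^sup>2 * (?h * (1 + ?h))" by algebra
    then have "sqrt ((1 + 2 * ?h)\<^sup>2 - 1) = 2 * sqrt (?h * (1 + ?h))"
      by (simp only: real_sqrt_mult real_sqrt_abs)
    then show ?thesis using 3 r
      by (simp add: geod_def model_dist_def gsin_def f sinh_arcosh_real)
  qed
qed

lemma initial_vector_eq:
  assumes "p \<in> model_space \<kappa>" "q \<in> model_space \<kappa>" "0 < hav \<kappa> p q" "sgn \<kappa> * hav \<kappa> p q < 1"
  shows "initial_vector \<kappa> p q = (1 / gsin (sgn \<kappa>) (hav \<kappa> p q)) *\<^sub>R tproj \<kappa> p q"
proof -
  define R where "R = gsin (sgn \<kappa>) (hav \<kappa> p q)"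
  have R: "R > 0" "R\<^sup>2 = 4 * (hav \<kappa> p q * (1 - sgn \<kappa> * hav \<kappa> p q))"
    using assms by (auto simp: R_def gsin_def power_mult_distrib)
  show ?thesis
    unfolding initial_vector_def geod_at_dist[OF assms(1,2)] R_def[symmetric]
  proof (rule the_equality, intro conjI)
    show "(1 / R) *\<^sub>R tproj \<kappa> p q \<in> unit_tangent \<kappa> p"
      using R tproj_form_self[OF assms(1,2)] tangent_linear(1)[OF tproj_tangent[OF assms(1,2)]]
      by (simp add: unit_tangent_iff model_form_linear field_simps power2_eq_square)
    show "(1 - 2 * sgn \<kappa> * hav \<kappa> p q) *\<^sub>R p + R *\<^sub>R (1 / R) *\<^sub>R tproj \<kappa> p q = q"
      using R by (simp add: tproj_def)
  next
    fix u assume "u \<in> unit_tangent \<kappa> p \<and> (1 - 2 * sgn \<kappa> * hav \<kappa> p q) *\<^sub>R p + R *\<^sub>R u = q"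
    then have "R *\<^sub>R u = tproj \<kappa> p q" by (auto simp: tproj_def algebra_simps)
    then have "(1 / R) *\<^sub>R (R *\<^sub>R u) = (1 / R) *\<^sub>R tproj \<kappa> p q" by simp
    then show "u = (1 / R) *\<^sub>R tproj \<kappa> p q" using R by simp
  qed
qed

section \<open>Angles and midpoints\<close>

lemma sgn_cases: "sgn \<kappa> \<in> {-1, 0, 1::real}" for \<kappa> :: real
  by (simp add: sgn_if)

text \<open>
  The law of cosines: the initial vectors are the normalised tangential parts.
\<close>

lemma angle_alpha_eq_ang:
  assumes "A \<in> model_space \<kappa>" "B \<in> model_space \<kappa>" "C \<in> model_space \<kappa>"
    and "admissible (sgn \<kappa>) (hav \<kappa> B C) (hav \<kappa> C A) (hav \<kappa> A B)"
  shows "angle_alpha \<kappa> (A, B, C) = ang (sgn \<kappa>) (hav \<kappa> B C) (hav \<kappa> C A) (hav \<kappa> A B)"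
proof -
  have B: "initial_vector \<kappa> A B = (1 / gsin (sgn \<kappa>) (hav \<kappa> A B)) *\<^sub>R tproj \<kappa> A B"
    using assms by (intro initial_vector_eq) (auto simp: admissible_def)
  have C: "initial_vector \<kappa> A C = (1 / gsin (sgn \<kappa>) (hav \<kappa> C A)) *\<^sub>R tproj \<kappa> A C"
    using assms initial_vector_eq[of A \<kappa> C] by (auto simp: admissible_def hav_commute[of \<kappa> A C])
  show ?thesis
    unfolding angle_alpha.simps geod_angle_def B C model_form_linear tproj_form[OF assms(1-3)] ang_def gprod_def
    by (simp add: hav_commute[of \<kappa> A C] algebra_simps add_divide_distrib diff_divide_distrib)
qed

text \<open>
  A geodesic fills the whole component of the conic in the plane spanned by \<open>p\<close> and \<open>u\<close>: a circle, a line, or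
  a branch of a hyperbola.
\<close>

lemma geod_range:
  assumes "\<kappa> = 0 \<Longrightarrow> c = 1" "\<kappa> > 0 \<Longrightarrow> c\<^sup>2 + k\<^sup>2 = 1" "\<kappa> < 0 \<Longrightarrow> c\<^sup>2 = 1 + k\<^sup>2 \<and> c > 0"
  shows "c *\<^sub>R p + k *\<^sub>R u \<in> range (geod \<kappa> p u)"
proof -
  consider "\<kappa> = 0" | "\<kappa> > 0" | "\<kappa> < 0" by linarith
  then have "\<exists>t. c *\<^sub>R p + k *\<^sub>R u = geod \<kappa> p u t"
  proof cases
    case 1
    then show ?thesis using assms by (auto simp: geod_def)
  next
    case 2
    then obtain t where "c = cos t" "k = sin t" using assms(2) sincos_total_2pi by metis
    then have "c *\<^sub>R p + k *\<^sub>R u = geod \<kappa> p u (t / sqrt \<kappa>)" using 2 by (simp add: geod_def)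
    then show ?thesis ..
  next
    case 3
    have "sqrt (k\<^sup>2 + 1) = c" using assms(3)[OF 3] by (intro real_sqrt_unique) auto
    then have "c = cosh (arsinh k)" by (simp add: cosh_arsinh_real)
    then have "c *\<^sub>R p + k *\<^sub>R u = geod \<kappa> p u (arsinh k / sqrt (- \<kappa>))" using 3 by (simp add: geod_def)
    then show ?thesis ..
  qed
  then show ?thesis by auto
qed

lemma on_geodesic_if_tproj_parallel:
  assumes "p \<in> model_space \<kappa>" "x \<in> model_space \<kappa>" "u \<in> unit_tangent \<kappa> p" "tproj \<kappa> p x = k *\<^sub>R u"
  shows "x \<in> range (geod \<kappa> p u)"
proof -
  define h where "h = hav \<kappa> p x"
  have "x = (1 - 2 * sgn \<kappa> * h) *\<^sub>R p + k *\<^sub>R u" using assms(4) by (simp add: tproj_def h_def algebra_simps)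
  moreover have "k\<^sup>2 = 4 * (h * (1 - sgn \<kappa> * h))"
    using tproj_form_self[OF assms(1,2)] assms(3,4)
    by (simp add: model_form_linear unit_tangent_iff power2_eq_square h_def)
  then have "(1 - 2 * sgn \<kappa> * h) *\<^sub>R p + k *\<^sub>R u \<in> range (geod \<kappa> p u)"
    using hav_bounds(1)[OF assms(1,2)]
    by (intro geod_range) (auto simp: h_def algebra_simps power2_eq_square)
  ultimately show ?thesis by simp
qed

lemma normalised_tangent:
  assumes "p \<in> model_space \<kappa>" "tangent \<kappa> p v" "v \<noteq> 0"
  shows "(1 / sqrt (model_form \<kappa> v v)) *\<^sub>R v \<in> unit_tangent \<kappa> p"
  using tangent_form_pos[OF assms] assms(2)
  by (simp add: unit_tangent_iff tangent_linear model_form_linear field_simps)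

lemma unit_tangent_exists:
  assumes "p \<in> model_space \<kappa>"
  shows "\<exists>u. u \<in> unit_tangent \<kappa> p"
proof -
  define v :: "real^3" where
    "v = (if \<kappa> = 0 \<or> p$1 = 0 \<and> p$2 = 0 then vector [1, 0, 0] else vector [p$2, - p$1, 0])"
  have "tangent \<kappa> p v" by (auto simp: v_def tangent_def model_form_def)
  moreover have "v $ 1 \<noteq> 0 \<or> v $ 2 \<noteq> 0" by (auto simp: v_def)
  then have "v \<noteq> 0" by auto
  ultimately show ?thesis using normalised_tangent[OF assms] by blast
qed

text \<open>
  The equality case of the Cauchy-Schwarz inequality in the (positive definite) tangent plane.
\<close>

lemma tangent_parallel:
  assumes p: "p \<in> model_space \<kappa>" and U: "tangent \<kappa> p U" and V: "tangent \<kappa> p V"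
    and le: "model_form \<kappa> U U * model_form \<kappa> V V \<le> (model_form \<kappa> U V)\<^sup>2"
  shows "\<exists>u \<in> unit_tangent \<kappa> p. \<exists>j k. U = j *\<^sub>R u \<and> V = k *\<^sub>R u"
proof (cases "U = 0")
  case True
  show ?thesis
  proof (cases "V = 0")
    case True
    obtain u where "u \<in> unit_tangent \<kappa> p" using unit_tangent_exists[OF p] by blast
    with True \<open>U = 0\<close> show ?thesis by (metis scaleR_zero_left)
  next
    case False
    have "V = sqrt (model_form \<kappa> V V) *\<^sub>R (1 / sqrt (model_form \<kappa> V V)) *\<^sub>R V"
      using tangent_form_pos[OF p V False] by simp
    moreover have "U = 0 *\<^sub>R (1 / sqrt (model_form \<kappa> V V)) *\<^sub>R V" using True by simp
    ultimately show ?thesis using normalised_tangent[OF p V False] by blast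
  qed
next
  case False
  define UU where "UU = model_form \<kappa> U U"
  define UV where "UV = model_form \<kappa> U V"
  have pos: "UU > 0" using tangent_form_pos[OF p U False] by (simp add: UU_def)
  \<comment> \<open>A multiple of the part of \<open>V\<close> orthogonal to \<open>U\<close>.\<close>
  define W where "W = UU *\<^sub>R V - UV *\<^sub>R U"
  have "tangent \<kappa> p W" unfolding W_def using U V by (intro tangent_linear)
  moreover have "model_form \<kappa> W W = UU * (UU * model_form \<kappa> V V - UV\<^sup>2)"
    by (simp add: W_def model_form_linear UU_def UV_def model_form_commute[of \<kappa> V U]
      algebra_simps power2_eq_square)
  then have "model_form \<kappa> W W \<le> 0" using le pos by (simp add: UU_def UV_def mult_le_0_iff)
  ultimately have "W = 0" using tangent_form_pos[OF p, of W] by fastforce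
  then have "(1 / UU) *\<^sub>R (UU *\<^sub>R V) = (1 / UU) *\<^sub>R (UV *\<^sub>R U)" by (simp add: W_def)
  then have "V = (UV / UU) *\<^sub>R U" using pos by simp
  moreover have U1: "U = sqrt UU *\<^sub>R (1 / sqrt UU) *\<^sub>R U" using pos by simp
  ultimately have "V = (UV / UU * sqrt UU) *\<^sub>R (1 / sqrt UU) *\<^sub>R U"
    by (metis scaleR_scaleR)
  then show ?thesis using U1 normalised_tangent[OF p U False, folded UU_def] by blast
qed

text \<open>
  If the Gram determinant vanishes, the tangential parts of \<open>B\<close> and \<open>C\<close> at \<open>A\<close> are parallel to one unit
  vector, and the geodesic in this direction passes through all three vertices.
\<close>

lemma nondegenerate_imp_gram_pos:
  assumes "A \<in> model_space \<kappa>" "B \<in> model_space \<kappa>" "C \<in> model_space \<kappa>" "nondegenerate \<kappa> (A, B, C)"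
  shows "0 < gram (sgn \<kappa>) (hav \<kappa> B C) (hav \<kappa> C A) (hav \<kappa> A B)"
proof (rule ccontr)
  assume neg: "\<not> ?thesis"
  define U where "U = tproj \<kappa> A B"
  define V where "V = tproj \<kappa> A C"
  have "model_form \<kappa> U U * model_form \<kappa> V V - (model_form \<kappa> U V)\<^sup>2 =
     4 * gram (sgn \<kappa>) (hav \<kappa> B C) (hav \<kappa> C A) (hav \<kappa> A B)"
    unfolding U_def V_def tproj_form_self[OF assms(1,2)] tproj_form_self[OF assms(1,3)]
      tproj_form[OF assms(1-3)] gram_def gprod_def hav_commute[of \<kappa> A C]
    by algebra
  then have "model_form \<kappa> U U * model_form \<kappa> V V \<le> (model_form \<kappa> U V)\<^sup>2" using neg by simp
  then obtain u j k where u: "u \<in> unit_tangent \<kappa> A" "U = j *\<^sub>R u" "V = k *\<^sub>R u"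
    using tangent_parallel[OF assms(1)] tproj_tangent assms unfolding U_def V_def by metis
  have "tproj \<kappa> A A = 0 *\<^sub>R u" by (simp add: tproj_def)
  then have "A \<in> range (geod \<kappa> A u)" "B \<in> range (geod \<kappa> A u)" "C \<in> range (geod \<kappa> A u)"
    using on_geodesic_if_tproj_parallel[OF assms(1) _ u(1)] u(2,3) assms(1-3)
    unfolding U_def V_def by metis+
  then have "{A, B, C} \<subseteq> range (geod \<kappa> A u)" by simp
  moreover have "geodesic_line \<kappa> (range (geod \<kappa> A u))" using u(1) assms(1) by (auto simp: geodesic_line_def)
  ultimately have "\<exists>S. geodesic_line \<kappa> S \<and> {A, B, C} \<subseteq> S" by (intro exI conjI)
  then show False using assms(4) by (simp only: nondegenerate.simps not_True_eq_False)
qed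

lemma half_cos_eq:
  assumes "s \<in> {-1, 1}" "s * h \<le> 1" "1 - 2 * s * h' = halfcos s h"
  shows "h' = half s h"
proof -
  have m: "halfcos s h \<ge> 0" "(halfcos s h)\<^sup>2 = 1 - s * h" using assms(2) by (auto simp: halfcos_def)
  have "s * s = 1" using assms(1) by auto
  then have "2 * h' = s * (1 - halfcos s h)" using assms(3) by algebra
  moreover have "s * (1 - halfcos s h) * (1 + halfcos s h) = h" using m(2) \<open>s * s = 1\<close> by algebra
  ultimately have "2 * h' * (1 + halfcos s h) = h" by simp
  then show ?thesis using m(1) by (simp add: half_def field_simps)
qed

text \<open>
  The half-angle formulas for \<open>cos\<close> and \<open>cosh\<close>; it characterises both halves of a bisected segment.
\<close>

lemma half_dist_hav:
  assumes "x \<in> model_space \<kappa>" "y \<in> model_space \<kappa>" "x' \<in> model_space \<kappa>" "y' \<in> model_space \<kappa>"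
    and d: "model_dist \<kappa> x' y' = model_dist \<kappa> x y / 2"
  shows "hav \<kappa> x' y' = half (sgn \<kappa>) (hav \<kappa> x y)"
proof -
  let ?h = "hav \<kappa> x y" and ?h' = "hav \<kappa> x' y'"
  note b = hav_bounds[OF assms(1,2)] hav_bounds[OF assms(3,4)]
  have scale: "a / r = b / (r * 2) \<Longrightarrow> r \<noteq> 0 \<Longrightarrow> a = b / 2" for a b r :: real
    by (simp add: field_simps)
  consider "\<kappa> = 0" | "\<kappa> > 0" | "\<kappa> < 0" by linarith
  then show ?thesis
  proof cases
    case 1
    have "sqrt ?h' = sqrt ?h / 2" using d assms(1-4) 1 by (simp add: model_dist_flat)
    then have "(sqrt ?h')\<^sup>2 = (sqrt ?h / 2)\<^sup>2" by (simp only:)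
    then show ?thesis using b 1 by (simp add: flat_case power_divide)
  next
    case 2
    have f: "model_form \<kappa> x y = 1 - 2 * ?h" "model_form \<kappa> x' y' = 1 - 2 * ?h'"
      using model_form_hav[of \<kappa>] 2 assms by simp_all
    define t where "t = arccos (1 - 2 * ?h) / 2"
    have r: "- 1 \<le> 1 - 2 * ?h" "1 - 2 * ?h \<le> 1" "- 1 \<le> 1 - 2 * ?h'" "1 - 2 * ?h' \<le> 1" using b 2 by auto
    have "arccos (1 - 2 * ?h') / sqrt \<kappa> = arccos (1 - 2 * ?h) / (sqrt \<kappa> * 2)"
      using d 2 by (simp add: model_dist_def f)
    from scale[OF this] have "arccos (1 - 2 * ?h') = t" using 2 by (simp add: t_def)
    then have "1 - 2 * ?h' = cos t" using r by (metis cos_arccos)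
    moreover have "cos t = sqrt (1 - ?h)"
    proof -
      have "cos (2 * t) = 1 - 2 * ?h" using r by (simp add: t_def)
      then have "(cos t)\<^sup>2 = 1 - ?h" by (simp add: cos_double_cos)
      moreover have "0 \<le> cos t" using arccos_bounded[OF r(1,2)] by (intro cos_ge_zero) (auto simp: t_def)
      ultimately show ?thesis by (metis real_sqrt_unique)
    qed
    ultimately show ?thesis using 2 b by (intro half_cos_eq) (auto simp: halfcos_def)
  next
    case 3
    have f: "- model_form \<kappa> x y = 1 + 2 * ?h" "- model_form \<kappa> x' y' = 1 + 2 * ?h'"
      using model_form_hav[of \<kappa>] 3 assms by simp_all
    define t where "t = arcosh (1 + 2 * ?h) / 2"
    have r: "1 \<le> 1 + 2 * ?h" "1 \<le> 1 + 2 * ?h'" using b by auto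
    have "arcosh (1 + 2 * ?h') / sqrt (- \<kappa>) = arcosh (1 + 2 * ?h) / (sqrt (- \<kappa>) * 2)"
      using d 3 by (simp add: model_dist_def f)
    from scale[OF this] have "arcosh (1 + 2 * ?h') = t" using 3 by (simp add: t_def)
    then have "1 + 2 * ?h' = cosh t" using r by (metis cosh_arcosh_real)
    moreover have "cosh t = sqrt (1 + ?h)"
    proof -
      have "cosh (2 * t) = 1 + 2 * ?h" using r by (simp add: t_def)
      then have "(cosh t)\<^sup>2 = 1 + ?h" by (simp add: cosh_double_cosh)
      then show ?thesis by (metis real_sqrt_unique cosh_real_nonneg)
    qed
    ultimately show ?thesis using 3 b by (intro half_cos_eq) (auto simp: halfcos_def)
  qed
qed

text \<open>
  The metric conditions determine the inner products of \<open>m\<close> with \<open>x\<close> and \<open>y\<close>. The difference between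
  \<open>m\<close> and the normalised sum of \<open>x\<close> and \<open>y\<close> is then tangent at \<open>m\<close> and has length \<open>0\<close>, so it vanishes by
  positive definiteness. In particular midpoints are unique.
\<close>

lemma midpoint_eq:
  assumes "x \<in> model_space \<kappa>" "y \<in> model_space \<kappa>" "is_midpoint \<kappa> m x y" "sgn \<kappa> * hav \<kappa> x y < 1"
  shows "m = (1 / (2 * halfcos (sgn \<kappa>) (hav \<kappa> x y))) *\<^sub>R (x + y)"
    and "hav \<kappa> x m = half (sgn \<kappa>) (hav \<kappa> x y)" "hav \<kappa> m y = half (sgn \<kappa>) (hav \<kappa> x y)"
proof -
  let ?h = "hav \<kappa> x y" and ?s = "sgn \<kappa>"
  define \<mu> where "\<mu> = halfcos ?s ?h"
  have \<mu>: "\<mu> > 0" "\<mu>\<^sup>2 = 1 - ?s * ?h" using halfcos_pos halfcos_sq assms(4) by (auto simp: \<mu>_def)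
  have m: "m \<in> model_space \<kappa>" using assms(3) by (simp add: is_midpoint_def)
  show 1: "hav \<kappa> x m = half ?s ?h" and 2: "hav \<kappa> m y = half ?s ?h"
    using assms(1-3) half_dist_hav[of x \<kappa> y x m] half_dist_hav[of x \<kappa> y m y] by (auto simp: is_midpoint_def)
  define v where "v = (1 / (2 * \<mu>)) *\<^sub>R (x + y) - m"
  have "tangent \<kappa> m v \<and> model_form \<kappa> v v = 0"
  proof (cases "\<kappa> = 0")
    case True
    have "\<mu> = 1" using True by (simp add: \<mu>_def flat_case)
    then have "tangent \<kappa> m v" using True assms(1,2) m
      by (simp add: tangent_def v_def model_space_flat)
    moreover have "model_form \<kappa> v v = 2 * hav \<kappa> x m + 2 * hav \<kappa> m y - hav \<kappa> x y"
      by (simp add: v_def \<open>\<mu> = 1\<close> hav_def model_form_def) (simp add: field_simps)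
    ultimately show ?thesis using 1 2 True by (simp add: flat_case)
  next
    case False
    have c: "?s - 2 * half ?s ?h = ?s * \<mu>"
    proof (cases "?h = 0")
      case True
      then show ?thesis by (simp add: half_def \<mu>_def halfcos_def)
    next
      case False
      then have "1 - 2 * ?s * half ?s ?h = \<mu>" unfolding \<mu>_def
        using hav_bounds(1)[OF assms(1,2)] assms(4) by (intro half_props(2)) auto
      then have "?s * (1 - 2 * ?s * half ?s ?h) = ?s * \<mu>" by simp
      then show ?thesis using sgn_mult_self[OF \<open>\<kappa> \<noteq> 0\<close>] by (simp add: algebra_simps)
    qed
    have f: "model_form \<kappa> m x = ?s * \<mu>" "model_form \<kappa> m y = ?s * \<mu>" "model_form \<kappa> m m = ?s"
      "model_form \<kappa> x x = ?s" "model_form \<kappa> y y = ?s" "model_form \<kappa> x y = ?s - 2 * ?h" "model_form \<kappa> y x = ?s - 2 * ?h"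
      "model_form \<kappa> x m = ?s * \<mu>" "model_form \<kappa> y m = ?s * \<mu>"
      using False m assms(1,2) 1 2 c
      by (simp_all add: model_form_hav model_form_self hav_commute[of \<kappa> m x] hav_commute[of \<kappa> y m]  hav_commute[of \<kappa> y x])
    have t: "tangent \<kappa> m v" using False \<mu>(1) by (simp add: tangent_def v_def model_form_linear f)
    have "?s * ?s = 1" using False by (rule sgn_mult_self)
    then have "4 * ?s - 4 * ?h = 4 * ?s * \<mu>\<^sup>2" unfolding \<mu>(2) by algebra
    moreover have "model_form \<kappa> v v = (1 / (2 * \<mu>))\<^sup>2 * (4 * ?s - 4 * ?h) - ?s"
      using \<mu>(1) by (simp add: v_def model_form_linear f power2_eq_square) (simp add: field_simps)
    ultimately have "model_form \<kappa> v v = 0" using \<mu>(1) by (simp add: field_simps)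
    with t show ?thesis ..
  qed
  then have "v = 0" using tangent_form_pos[OF m, of v] by fastforce
  then show "m = (1 / (2 * halfcos ?s ?h)) *\<^sub>R (x + y)" by (simp add: v_def \<mu>_def)
qed

text \<open>
  Both midpoints are multiples of sums of vertices, so their inner product is a
  sum of four known ones.
\<close>

lemma hav_between_midpoints:
  assumes "A \<in> model_space \<kappa>" "B \<in> model_space \<kappa>" "C \<in> model_space \<kappa>"
    and X: "is_midpoint \<kappa> X B C" and Z: "is_midpoint \<kappa> Z A B"
    and lt: "sgn \<kappa> * hav \<kappa> B C < 1" "sgn \<kappa> * hav \<kappa> A B < 1"
  shows "hav \<kappa> X Z = midline (sgn \<kappa>) (hav \<kappa> C A) (hav \<kappa> B C) (hav \<kappa> A B)"
proof -
  let ?s = "sgn \<kappa>"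
  define p q w where "p = hav \<kappa> B C" and "q = hav \<kappa> C A" and "w = hav \<kappa> A B"
  define a c where "a = halfcos ?s p" and "c = halfcos ?s w"
  have m: "a > 0" "c > 0" "a\<^sup>2 = 1 - ?s * p" "c\<^sup>2 = 1 - ?s * w"
    unfolding a_def c_def p_def w_def using lt by (simp_all only: halfcos_pos halfcos_sq)
  have XZ: "X = (1 / (2 * a)) *\<^sub>R (B + C)" "Z = (1 / (2 * c)) *\<^sub>R (A + B)"
    using midpoint_eq(1)[OF assms(2,3) X lt(1)] midpoint_eq(1)[OF assms(1,2) Z lt(2)]
    by (simp_all add: a_def c_def p_def w_def)
  have "hav \<kappa> X Z = midline ?s q p w"
  proof (cases "\<kappa> = 0")
    case True
    then have "a = 1" "c = 1" by (simp_all add: a_def c_def flat_case)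
    then show ?thesis using True unfolding XZ q_def
      by (simp add: hav_def model_form_def flat_case) (simp add: field_simps)
  next
    case False
    have X': "X \<in> model_space \<kappa>" "Z \<in> model_space \<kappa>" using X Z by (auto simp: is_midpoint_def)
    have s2: "?s * ?s = 1" using False by (rule sgn_mult_self)
    have "model_form \<kappa> X Z * (4 * a * c) = 4 * ?s - 2 * w - 2 * q - 2 * p"
      unfolding XZ model_form_linear using m(1,2) False assms(1-3)
      by (simp add: model_form_hav model_form_self p_def q_def w_def hav_commute[of \<kappa> B A] hav_commute[of \<kappa> C B] field_simps)
    then have "(?s - 2 * hav \<kappa> X Z) * (2 * a * c) = 2 * ?s - w - q - p"
      using model_form_hav[OF False X'] by simp
    then have "(1 - 2 * ?s * hav \<kappa> X Z) * (a * c) = 1 - ?s * (p + q + w) / 2"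
      using s2 by algebra
    also have "\<dots> = (1 - 2 * ?s * midline ?s q p w) * (a * c)"
      using midline_cos[OF sgn_cases, of \<kappa> p w q] m(1,2) lt by (simp add: a_def c_def p_def w_def)
    finally have "?s * hav \<kappa> X Z = ?s * midline ?s q p w" using m(1,2) by simp
    then show ?thesis using False by (simp add: sgn_zero_iff)
  qed
  then show ?thesis by (simp add: p_def q_def w_def)
qed

fun hav_a :: "real \<Rightarrow> triangle \<Rightarrow> real" where "hav_a \<kappa> (A, B, C) = hav \<kappa> B C"
fun hav_b :: "real \<Rightarrow> triangle \<Rightarrow> real" where "hav_b \<kappa> (A, B, C) = hav \<kappa> C A"
fun hav_c :: "real \<Rightarrow> triangle \<Rightarrow> real" where "hav_c \<kappa> (A, B, C) = hav \<kappa> A B"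

lemma medial_child_sides:
  assumes "geodesic_triangle \<kappa> T" "medial_child \<kappa> T T'"
    and "admissible (sgn \<kappa>) (hav_a \<kappa> T) (hav_b \<kappa> T) (hav_c \<kappa> T)"
  shows "(hav_a \<kappa> T', hav_b \<kappa> T', hav_c \<kappa> T') \<in>
    child_sides (sgn \<kappa>) (hav_a \<kappa> T) (hav_b \<kappa> T) (hav_c \<kappa> T)"
proof -
  obtain A B C where T: "T = (A, B, C)" by (cases T)
  have M: "A \<in> model_space \<kappa>" "B \<in> model_space \<kappa>" "C \<in> model_space \<kappa>" using assms(1) T by auto
  obtain X Y Z where m: "is_midpoint \<kappa> X B C" "is_midpoint \<kappa> Y C A" "is_midpoint \<kappa> Z A B"
    and T': "T' \<in> {(X, Y, Z), (A, Z, Y), (Z, B, X), (Y, X, C)}" using assms(2) T by auto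
  have lt: "sgn \<kappa> * hav \<kappa> B C < 1" "sgn \<kappa> * hav \<kappa> C A < 1" "sgn \<kappa> * hav \<kappa> A B < 1"
    using assms(3) T by (auto simp: admissible_def)
  note h = midpoint_eq(2,3)[OF M(2,3) m(1) lt(1)] midpoint_eq(2,3)[OF M(3,1) m(2) lt(2)]
    midpoint_eq(2,3)[OF M(1,2) m(3) lt(3)]
  have l: "hav \<kappa> X Z = midline (sgn \<kappa>) (hav \<kappa> C A) (hav \<kappa> B C) (hav \<kappa> A B)"
    "hav \<kappa> Y X = midline (sgn \<kappa>) (hav \<kappa> A B) (hav \<kappa> B C) (hav \<kappa> C A)"
    "hav \<kappa> Z Y = midline (sgn \<kappa>) (hav \<kappa> B C) (hav \<kappa> C A) (hav \<kappa> A B)"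
    using hav_between_midpoints[OF M(1,2,3) m(1,3) lt(1,3)]
      hav_between_midpoints[OF M(2,3,1) m(2,1) lt(2,1)]
      hav_between_midpoints[OF M(3,1,2) m(3,2) lt(3,2)]
    by (simp_all only: midline_swap[of _ "hav \<kappa> A B" "hav \<kappa> C A"]
      midline_swap[of _ "hav \<kappa> B C" "hav \<kappa> A B"])
  then have l': "hav \<kappa> Z X = midline (sgn \<kappa>) (hav \<kappa> C A) (hav \<kappa> B C) (hav \<kappa> A B)"
    "hav \<kappa> X Y = midline (sgn \<kappa>) (hav \<kappa> A B) (hav \<kappa> B C) (hav \<kappa> C A)"
    "hav \<kappa> Y Z = midline (sgn \<kappa>) (hav \<kappa> B C) (hav \<kappa> C A) (hav \<kappa> A B)"
    by (simp_all only: hav_commute[of \<kappa> Z X] hav_commute[of \<kappa> X Y] hav_commute[of \<kappa> Y Z])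
  from T' consider "T' = (X, Y, Z)" | "T' = (A, Z, Y)" | "T' = (Z, B, X)" | "T' = (Y, X, C)" by blast
  then show ?thesis by cases (simp_all add: child_sides_def T h l l')
qed

text \<open>
  All triangles of the sequence are non-degenerate, because subdivision multiplies the Gram
  determinant by a positive factor.
\<close>

lemma nested_admissible:
  assumes "nested_triangles \<kappa> t" "nondegenerate \<kappa> (t 0)"
  shows "admissible (sgn \<kappa>) (hav_a \<kappa> (t n)) (hav_b \<kappa> (t n)) (hav_c \<kappa> (t n))"
proof -
  have adm: "admissible (sgn \<kappa>) (hav_a \<kappa> (t n)) (hav_b \<kappa> (t n)) (hav_c \<kappa> (t n))"
    if "0 < gram (sgn \<kappa>) (hav_a \<kappa> (t n)) (hav_b \<kappa> (t n)) (hav_c \<kappa> (t n))" for n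
  proof -
    obtain A B C where T: "t n = (A, B, C)" by (cases "t n")
    have "geodesic_triangle \<kappa> (t n)" using assms(1) by (simp add: nested_triangles_def)
    then have "A \<in> model_space \<kappa>" "B \<in> model_space \<kappa>" "C \<in> model_space \<kappa>" using T by auto
    then show ?thesis using that unfolding T
      by (intro gram_nonneg_imp_admissible sgn_cases) (simp_all add: hav_bounds)
  qed
  show ?thesis
  proof (induction n)
    case 0
    obtain A B C where T: "t 0 = (A, B, C)" by (cases "t 0")
    have "geodesic_triangle \<kappa> (t 0)" using assms(1) by (simp add: nested_triangles_def)
    then have "0 < gram (sgn \<kappa>) (hav \<kappa> B C) (hav \<kappa> C A) (hav \<kappa> A B)"
      using T assms(2) by (intro nondegenerate_imp_gram_pos) auto
    then show ?case using adm[of 0] T by simp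
  next
    case (Suc n)
    have "geodesic_triangle \<kappa> (t n)" "medial_child \<kappa> (t n) (t (Suc n))"
      using assms(1) by (auto simp: nested_triangles_def)
    from adm[OF gram_child_pos[OF Suc medial_child_sides[OF this Suc]]] show ?case .
  qed
qed

section \<open>Gnomonic projection of spherical triangles\<close>

text \<open>
  The point \<open>x\<close> divides the segment from \<open>a\<close> to \<open>b\<close> in two parts, each at most the fraction \<open>r\<close> of it.
\<close>

definition on_seg :: "real \<Rightarrow> 'a::real_normed_vector \<Rightarrow> 'a \<Rightarrow> 'a \<Rightarrow> bool" where
  "on_seg r x a b \<longleftrightarrow> (\<exists>t. 0 \<le> t \<and> t \<le> r \<and> 0 \<le> 1 - t \<and> 1 - t \<le> r \<and> x = a + t *\<^sub>R (b - a))"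

lemma on_seg_sym: "on_seg r x a b \<Longrightarrow> on_seg r x b a"
  unfolding on_seg_def
proof (elim exE conjE)
  fix t assume "0 \<le> t" "t \<le> r" "0 \<le> 1 - t" "1 - t \<le> r" "x = a + t *\<^sub>R (b - a)"
  then show "\<exists>t. 0 \<le> t \<and> t \<le> r \<and> 0 \<le> 1 - t \<and> 1 - t \<le> r \<and> x = b + t *\<^sub>R (a - b)"
    by (intro exI[of _ "1 - t"]) (simp add: algebra_simps)
qed

text \<open>
  If \<open>t \<le> u\<close>, the difference of the two points is \<open>t *\<^sub>R (c - b) + (u - t) *\<^sub>R (c - a)\<close> up to sign,
  a combination of sides with total weight \<open>u \<le> r\<close>.
\<close>

lemma dist_from_common_corner:
  fixes a b c :: "'a::real_normed_vector"
  assumes "dist a b \<le> D" "dist a c \<le> D" "dist b c \<le> D" "0 \<le> t" "t \<le> r" "0 \<le> u" "u \<le> r"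
  shows "dist (a + t *\<^sub>R (b - a)) (a + u *\<^sub>R (c - a)) \<le> r * D"
  using assms
proof (induction t u arbitrary: b c rule: linorder_wlog)
  case (le t u)
  have "(a + u *\<^sub>R (c - a)) - (a + t *\<^sub>R (b - a)) = t *\<^sub>R (c - b) + (u - t) *\<^sub>R (c - a)"
    by (simp add: algebra_simps)
  then have "dist (a + u *\<^sub>R (c - a)) (a + t *\<^sub>R (b - a))
      = norm (t *\<^sub>R (c - b) + (u - t) *\<^sub>R (c - a))" by (simp only: dist_norm)
  then have "dist (a + t *\<^sub>R (b - a)) (a + u *\<^sub>R (c - a)) = norm (t *\<^sub>R (c - b) + (u - t) *\<^sub>R (c - a))"
    by (simp only: dist_commute)
  also have "\<dots> \<le> t * dist b c + (u - t) * dist a c"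
    using norm_triangle_ineq[of "t *\<^sub>R (c - b)" "(u - t) *\<^sub>R (c - a)"] le
    by (simp add: dist_norm norm_minus_commute)
  also have "\<dots> \<le> t * D + (u - t) * D" using le by (intro add_mono mult_left_mono) auto
  also have "\<dots> = u * D" by (simp add: algebra_simps)
  also have "\<dots> \<le> r * D"
    using le zero_le_dist[of a b] by (intro mult_right_mono) linarith+
  finally show ?case .
next
  case (sym t u)
  then show ?case using sym(1)[of c b] by (simp add: dist_commute)
qed

lemma on_seg_dist:
  assumes "on_seg r x a b" "on_seg r y a c" "dist a b \<le> D" "dist a c \<le> D" "dist b c \<le> D"
  shows "dist x y \<le> r * D" "dist a x \<le> r * D"
proof -
  obtain t u where "0 \<le> t" "t \<le> r" "x = a + t *\<^sub>R (b - a)" "0 \<le> u" "u \<le> r" "y = a + u *\<^sub>R (c - a)"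
    using assms(1,2) unfolding on_seg_def by blast
  then show "dist x y \<le> r * D" "dist a x \<le> r * D"
    using dist_from_common_corner[OF assms(3-5), of t r u] dist_from_common_corner[OF assms(3-5), of t r 0]
    by (auto simp: dist_commute)
qed

text \<open>
  Central projection to the plane \<open>z \<bullet> v = 1\<close>, tangent to the unit sphere at the unit vector \<open>z\<close>. It maps great circles of
  the open hemisphere around \<open>z\<close> to straight lines.
\<close>

definition gnomonic :: "'a::real_inner \<Rightarrow> 'a \<Rightarrow> 'a" where
  "gnomonic z x = x /\<^sub>R (z \<bullet> x)"

lemma model_form_inner: "\<kappa> > 0 \<Longrightarrow> model_form \<kappa> x y = x \<bullet> y"
  by (simp add: model_form_def inner_vec_def sum_3)

lemma norm_model_space: "\<kappa> > 0 \<Longrightarrow> x \<in> model_space \<kappa> \<Longrightarrow> norm x = 1"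
  using model_form_inner[of \<kappa> x x] by (simp add: model_space_def norm_eq_1)

text \<open>
  The projected points have norm at least \<open>1\<close>, and the radial projection back to the ball does not
  increase distances.
\<close>

lemma hav_le_gnomonic:
  assumes "\<kappa> > 0" "x \<in> model_space \<kappa>" "y \<in> model_space \<kappa>" "z \<in> model_space \<kappa>" "0 < z \<bullet> x" "0 < z \<bullet> y"
  shows "4 * hav \<kappa> x y \<le> (dist (gnomonic z x) (gnomonic z y))\<^sup>2"
proof -
  have n: "x \<bullet> x = 1" "y \<bullet> y = 1" "norm z = 1" "norm x = 1" "norm y = 1"
    using norm_model_space assms by (auto simp: norm_eq_1)
  define a where "a = inverse (z \<bullet> x)"
  define b where "b = inverse (z \<bullet> y)"
  have "z \<bullet> x \<le> 1" "z \<bullet> y \<le> 1" using norm_cauchy_schwarz[of z x] norm_cauchy_schwarz[of z y] n by auto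
  then have ab: "1 \<le> a" "1 \<le> b" using assms(5,6) by (auto simp: a_def b_def one_le_inverse_iff)
  have c: "x \<bullet> y \<le> 1" using norm_cauchy_schwarz[of x y] n by auto
  have "1 * 1 \<le> a * b" using ab by (intro mult_mono) auto
  then have "1 * (1 - x \<bullet> y) \<le> (a * b) * (1 - x \<bullet> y)" using c by (intro mult_right_mono) auto
  moreover have "(dist (gnomonic z x) (gnomonic z y))\<^sup>2 = (a - b)\<^sup>2 + 2 * ((a * b) * (1 - x \<bullet> y))"
    unfolding dist_norm gnomonic_def a_def[symmetric] b_def[symmetric] power2_norm_eq_inner
    by (simp add: inner_diff n inner_commute[of y x] algebra_simps power2_eq_square)
  moreover have "4 * hav \<kappa> x y = 2 * (1 - x \<bullet> y)"
    using assms(1) by (simp add: hav_def model_form_inner inner_diff n inner_commute[of y x])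
  ultimately show ?thesis using zero_le_power2[of "a - b"] by linarith
qed

text \<open>
  The spherical midpoint is a positive multiple of \<open>x + y\<close>, so its projection is the average of the two projected
  points with weights proportional to \<open>z \<bullet> x\<close> and \<open>z \<bullet> y\<close>, both of which lie in the
  interval from \<open>d\<close> to \<open>1\<close>. The bound \<open>d\<close> is inherited because the sum is divided by
  \<open>2 * halfcos 1 (hav \<kappa> x y) \<le> 2\<close>; hence the same ratio serves in every step.
\<close>

lemma gnomonic_midpoint:
  assumes "\<kappa> > 0" "x \<in> model_space \<kappa>" "y \<in> model_space \<kappa>" "z \<in> model_space \<kappa>"
    and "0 < d" "d \<le> z \<bullet> x" "d \<le> z \<bullet> y" "is_midpoint \<kappa> m x y" "hav \<kappa> x y < 1"
  shows "d \<le> z \<bullet> m" "on_seg (1 - d / 2) (gnomonic z m) (gnomonic z x) (gnomonic z y)"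
proof -
  have n: "norm z = 1" "norm x = 1" "norm y = 1"
    using norm_model_space assms by auto
  define a where "a = z \<bullet> x"
  define b where "b = z \<bullet> y"
  have ab: "d \<le> a" "a \<le> 1" "d \<le> b" "b \<le> 1" "0 < a + b"
    using norm_cauchy_schwarz[of z x] norm_cauchy_schwarz[of z y] n assms by (auto simp: a_def b_def)
  define \<mu> where "\<mu> = halfcos 1 (hav \<kappa> x y)"
  have \<mu>: "0 < \<mu>" "\<mu> \<le> 1" using assms(9) hav_bounds(1)[OF assms(2,3)] by (auto simp: \<mu>_def halfcos_def)
  have m: "m = (1 / (2 * \<mu>)) *\<^sub>R (x + y)"
    using midpoint_eq(1)[OF assms(2,3,8)] assms(1,9) by (simp add: \<mu>_def)
  have zm: "z \<bullet> m = (a + b) / (2 * \<mu>)" unfolding m by (simp add: a_def b_def inner_add_right)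
  have "d * \<mu> \<le> d * 1" using \<mu> assms(5) by (intro mult_left_mono) auto
  then have "d * (2 * \<mu>) \<le> a + b" using ab by linarith
  then show "d \<le> z \<bullet> m" unfolding zm using \<mu> by (simp add: field_simps)
  have pos: "0 < a" "0 < b" using ab assms(5) by auto
  have "gnomonic z m = (1 / (a + b)) *\<^sub>R (x + y)"
    unfolding gnomonic_def zm unfolding m using \<mu> ab(5) by simp
  also have "\<dots> = (1 / (a + b)) *\<^sub>R (a *\<^sub>R gnomonic z x + b *\<^sub>R gnomonic z y)"
    unfolding gnomonic_def a_def[symmetric] b_def[symmetric] using pos by simp
  also have "\<dots> = (a / (a + b)) *\<^sub>R gnomonic z x + (b / (a + b)) *\<^sub>R gnomonic z y"
    by (simp add: scaleR_add_right)
  also have "a / (a + b) = 1 - b / (a + b)" using ab(5) by (simp add: field_simps)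
  finally have "gnomonic z m = gnomonic z x + (b / (a + b)) *\<^sub>R (gnomonic z y - gnomonic z x)"
    by (simp add: algebra_simps)
  moreover have lb: "d / 2 \<le> b / (a + b)" "d / 2 \<le> a / (a + b)"
    using ab pos assms(5) by (intro frac_le; linarith)+
  ultimately show "on_seg (1 - d / 2) (gnomonic z m) (gnomonic z x) (gnomonic z y)"
    unfolding on_seg_def using \<open>a / (a + b) = _\<close> pos
    by (intro exI[of _ "b / (a + b)"]) auto
qed

text \<open>
  The triangle lies in the cap \<open>z \<bullet> v \<ge> d\<close>, and its projection has diameter at most \<open>D\<close>.
\<close>

fun gnomonic_within :: "real^3 \<Rightarrow> real \<Rightarrow> real \<Rightarrow> triangle \<Rightarrow> bool" where
  "gnomonic_within z d D (A, B, C) \<longleftrightarrow> d \<le> z \<bullet> A \<and> d \<le> z \<bullet> B \<and> d \<le> z \<bullet> C \<and>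
     dist (gnomonic z A) (gnomonic z B) \<le> D \<and> dist (gnomonic z B) (gnomonic z C) \<le> D \<and>
     dist (gnomonic z C) (gnomonic z A) \<le> D"

lemma gnomonic_within_child:
  assumes "\<kappa> > 0" "z \<in> model_space \<kappa>" "0 < d" "geodesic_triangle \<kappa> T" "medial_child \<kappa> T T'"
    and "admissible 1 (hav_a \<kappa> T) (hav_b \<kappa> T) (hav_c \<kappa> T)" "gnomonic_within z d D T"
  shows "gnomonic_within z d ((1 - d / 2) * D) T'"
proof -
  obtain A B C where T: "T = (A, B, C)" by (cases T)
  have M: "A \<in> model_space \<kappa>" "B \<in> model_space \<kappa>" "C \<in> model_space \<kappa>" using assms(4) T by auto
  obtain X Y Z where m: "is_midpoint \<kappa> X B C" "is_midpoint \<kappa> Y C A" "is_midpoint \<kappa> Z A B"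
    and T': "T' \<in> {(X, Y, Z), (A, Z, Y), (Z, B, X), (Y, X, C)}" using assms(5) T by auto
  have lt: "hav \<kappa> B C < 1" "hav \<kappa> C A < 1" "hav \<kappa> A B < 1"
    using assms(6) T by (auto simp: admissible_def)
  have D: "d \<le> z \<bullet> A" "d \<le> z \<bullet> B" "d \<le> z \<bullet> C"
     "dist (gnomonic z A) (gnomonic z B) \<le> D" "dist (gnomonic z B) (gnomonic z C) \<le> D"
     "dist (gnomonic z C) (gnomonic z A) \<le> D"
     "dist (gnomonic z B) (gnomonic z A) \<le> D" "dist (gnomonic z C) (gnomonic z B) \<le> D"
     "dist (gnomonic z A) (gnomonic z C) \<le> D"
    using assms(7) T by (auto simp: dist_commute)
  note x = gnomonic_midpoint[OF assms(1) M(2,3) assms(2,3) D(2,3) m(1) lt(1)]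
  note y = gnomonic_midpoint[OF assms(1) M(3,1) assms(2,3) D(3,1) m(2) lt(2)]
  note z = gnomonic_midpoint[OF assms(1) M(1,2) assms(2,3) D(1,2) m(3) lt(3)]
  have xz: "dist (gnomonic z X) (gnomonic z Z) \<le> (1 - d / 2) * D"
    "dist (gnomonic z B) (gnomonic z X) \<le> (1 - d / 2) * D"
    using on_seg_dist[OF x(2) on_seg_sym[OF z(2)]] D by auto
  have yx: "dist (gnomonic z Y) (gnomonic z X) \<le> (1 - d / 2) * D"
    "dist (gnomonic z C) (gnomonic z Y) \<le> (1 - d / 2) * D"
    using on_seg_dist[OF y(2) on_seg_sym[OF x(2)]] D by auto
  have zy: "dist (gnomonic z Z) (gnomonic z Y) \<le> (1 - d / 2) * D"
    "dist (gnomonic z A) (gnomonic z Z) \<le> (1 - d / 2) * D"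
    using on_seg_dist[OF z(2) on_seg_sym[OF y(2)]] D by auto
  have e: "dist (gnomonic z C) (gnomonic z X) \<le> (1 - d / 2) * D"
    "dist (gnomonic z A) (gnomonic z Y) \<le> (1 - d / 2) * D"
    "dist (gnomonic z B) (gnomonic z Z) \<le> (1 - d / 2) * D"
    using on_seg_dist(2)[OF on_seg_sym[OF x(2)] y(2)] on_seg_dist(2)[OF on_seg_sym[OF y(2)] z(2)]
      on_seg_dist(2)[OF on_seg_sym[OF z(2)] x(2)] D by auto
  show ?thesis using T' xz yx zy e x(1) y(1) z(1) D by (auto simp: dist_commute)
qed

section \<open>Nested sequences\<close>

lemma nested_child_sides:
  assumes "nested_triangles \<kappa> t" "nondegenerate \<kappa> (t 0)"
  shows "(hav_a \<kappa> (t (Suc n)), hav_b \<kappa> (t (Suc n)), hav_c \<kappa> (t (Suc n)))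
    \<in> child_sides (sgn \<kappa>) (hav_a \<kappa> (t n)) (hav_b \<kappa> (t n)) (hav_c \<kappa> (t n))"
  using assms(1) by (intro medial_child_sides nested_admissible[OF assms]) (auto simp: nested_triangles_def)

lemma nested_angle:
  assumes "nested_triangles \<kappa> t" "nondegenerate \<kappa> (t 0)"
  shows "angle_alpha \<kappa> (t n) = ang (sgn \<kappa>) (hav_a \<kappa> (t n)) (hav_b \<kappa> (t n)) (hav_c \<kappa> (t n))"
proof -
  obtain A B C where T: "t n = (A, B, C)" by (cases "t n")
  have "geodesic_triangle \<kappa> (t n)" using assms(1) by (simp add: nested_triangles_def)
  then show ?thesis using nested_admissible[OF assms, of n] angle_alpha_eq_ang[of A \<kappa> B C] T by simp
qed

text \<open>
  On the sphere the sides need not decrease noticeably in each step: the inner triangle of an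
  equilateral triangle close to a great circle has almost the same size. The diameters
  in the gnomonic projection, however, shrink by a fixed factor, which depends on how far \<open>t\<^sub>0\<close> stays
  from the boundary of the hemisphere.
\<close>

lemma nested_small:
  assumes "nested_triangles \<kappa> t" "nondegenerate \<kappa> (t 0)" "0 < \<delta>"
  shows "\<exists>n. hav_a \<kappa> (t n) \<le> \<delta> \<and> hav_b \<kappa> (t n) \<le> \<delta> \<and> hav_c \<kappa> (t n) \<le> \<delta>"
proof (cases "\<kappa> > 0")
  case False
  then have s: "sgn \<kappa> \<noteq> 1" by (simp add: sgn_if)
  define M where "M = hav_a \<kappa> (t 0) + hav_b \<kappa> (t 0) + hav_c \<kappa> (t 0)"
  have size: "hav_a \<kappa> (t n) \<le> M / 2 ^ n \<and> hav_b \<kappa> (t n) \<le> M / 2 ^ n \<and> hav_c \<kappa> (t n) \<le> M / 2 ^ n" for n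
  proof (induction n)
    case 0
    then show ?case using nested_admissible[OF assms(1,2), of 0] by (auto simp: admissible_def M_def)
  next
    case (Suc n)
    then have S: "hav_a \<kappa> (t n) \<le> M / 2 ^ n" "hav_b \<kappa> (t n) \<le> M / 2 ^ n" "hav_c \<kappa> (t n) \<le> M / 2 ^ n" by auto
    show ?case
      using child_sides_le_half[OF nested_admissible[OF assms(1,2)] S _ nested_child_sides[OF assms(1,2)]] s
      by (simp add: mult.commute)
  qed
  have "(\<lambda>n. M * (1 / 2) ^ n) \<longlonglongrightarrow> M * 0" by (intro tendsto_intros LIMSEQ_realpow_zero) auto
  then have "eventually (\<lambda>n. M * (1 / 2) ^ n < \<delta>) sequentially" using assms(3) by (intro order_tendstoD) auto
  then obtain n where "M * (1 / 2) ^ n < \<delta>" by (auto simp: eventually_sequentially)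
  then have "M / 2 ^ n < \<delta>" by (simp add: power_divide)
  then show ?thesis using size[of n] by (intro exI[of _ n]) auto
next
  case True
  obtain A B C where T: "t 0 = (A, B, C)" by (cases "t 0")
  have g: "geodesic_triangle \<kappa> (t n)" for n using assms(1) by (simp add: nested_triangles_def)
  from g[of 0] obtain z where z: "z \<in> model_space \<kappa>" "0 < z \<bullet> A" "0 < z \<bullet> B" "0 < z \<bullet> C"
    using True T by (auto simp: model_form_inner)
  define d where "d = Min {z \<bullet> A, z \<bullet> B, z \<bullet> C}"
  have d: "0 < d" "d \<le> z \<bullet> A" "d \<le> z \<bullet> B" "d \<le> z \<bullet> C" using z by (auto simp: d_def)
  have "d \<le> 1" using d(2) norm_cauchy_schwarz[of z A] norm_model_space[OF True] z(1) g[of 0] T by auto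
  define D where "D = dist (gnomonic z A) (gnomonic z B) + dist (gnomonic z B) (gnomonic z C)
     + dist (gnomonic z C) (gnomonic z A)"
  have within: "gnomonic_within z d ((1 - d / 2) ^ n * D) (t n)" for n
  proof (induction n)
    case 0
    then show ?case using T d by (simp add: D_def)
  next
    case (Suc n)
    have "medial_child \<kappa> (t n) (t (Suc n))" using assms(1) by (simp add: nested_triangles_def)
    then show ?case using gnomonic_within_child[OF True z(1) d(1) g _ _ Suc]
        nested_admissible[OF assms(1,2), of n] True
      by (simp add: mult.assoc)
  qed
  have "(\<lambda>n. (1 - d / 2) ^ n * D) \<longlonglongrightarrow> 0 * D"
    using d(1) \<open>d \<le> 1\<close> by (intro tendsto_intros LIMSEQ_realpow_zero) auto
  then have "eventually (\<lambda>n. (1 - d / 2) ^ n * D < sqrt \<delta>) sequentially"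
    using assms(3) by (intro order_tendstoD) auto
  then obtain n where n: "(1 - d / 2) ^ n * D < sqrt \<delta>" by (auto simp: eventually_sequentially)
  obtain A' B' C' where T': "t n = (A', B', C')" by (cases "t n")
  have M: "A' \<in> model_space \<kappa>" "B' \<in> model_space \<kappa>" "C' \<in> model_space \<kappa>" using g[of n] T' by auto
  have bound: "hav \<kappa> x y \<le> \<delta>" if "x \<in> model_space \<kappa>" "y \<in> model_space \<kappa>" "d \<le> z \<bullet> x" "d \<le> z \<bullet> y"
     "dist (gnomonic z x) (gnomonic z y) \<le> (1 - d / 2) ^ n * D" for x y
  proof -
    have "(dist (gnomonic z x) (gnomonic z y))\<^sup>2 \<le> (sqrt \<delta>)\<^sup>2" using that(5) n by (intro power_mono) auto
    then show ?thesis using hav_le_gnomonic[OF True that(1,2) z(1)] d(1) that(3,4) assms(3)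
       hav_bounds(1)[OF that(1,2)] by simp
  qed
  show ?thesis using within[of n] M unfolding T' by (intro exI[of _ n]) (simp add: T' bound)
qed

lemma hav_small_if_dist_small:
  assumes "0 < \<delta>"
  shows "\<exists>\<eta>>0. \<forall>x\<in>model_space \<kappa>. \<forall>y\<in>model_space \<kappa>. model_dist \<kappa> x y < \<eta> \<longrightarrow> hav \<kappa> x y < \<delta>"
proof -
  consider "\<kappa> = 0" | "\<kappa> > 0" | "\<kappa> < 0" by linarith
  then show ?thesis
  proof cases
    case 1
    have "hav \<kappa> x y < \<delta>" if "x \<in> model_space \<kappa>" "y \<in> model_space \<kappa>" "model_dist \<kappa> x y < 2 * sqrt \<delta>" for x y
      using 1 that by (simp add: model_dist_flat)
    then show ?thesis using assms by (intro exI[of _ "2 * sqrt \<delta>"]) auto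
  next
    case 2
    define \<delta>' where "\<delta>' = min \<delta> 1"
    have \<delta>': "0 < \<delta>'" "\<delta>' \<le> 1" "\<delta>' \<le> \<delta>" using assms by (auto simp: \<delta>'_def)
    have "hav \<kappa> x y < \<delta>" if "x \<in> model_space \<kappa>" "y \<in> model_space \<kappa>"
       "model_dist \<kappa> x y < arccos (1 - 2 * \<delta>') / sqrt \<kappa>" for x y
    proof -
      have "arccos (1 - 2 * hav \<kappa> x y) < arccos (1 - 2 * \<delta>')"
        using that 2 model_form_hav[of \<kappa> x y] by (simp add: model_dist_def divide_strict_right_mono field_simps)
      then have "1 - 2 * \<delta>' < 1 - 2 * hav \<kappa> x y"
        using \<delta>' hav_bounds[OF that(1,2)] 2 by (subst (asm) arccos_less_mono) auto
      then show ?thesis using \<delta>' by simp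
    qed
    moreover have "0 < arccos (1 - 2 * \<delta>')"
    proof -
      have "arccos 1 < arccos (1 - 2 * \<delta>')" using \<delta>' by (intro arccos_less_arccos) auto
      then show ?thesis by simp
    qed
    ultimately show ?thesis using 2 by (intro exI[of _ "arccos (1 - 2 * \<delta>') / sqrt \<kappa>"]) auto
  next
    case 3
    have "hav \<kappa> x y < \<delta>" if "x \<in> model_space \<kappa>" "y \<in> model_space \<kappa>"
       "model_dist \<kappa> x y < arcosh (1 + 2 * \<delta>) / sqrt (- \<kappa>)" for x y
    proof -
      have "arcosh (1 + 2 * hav \<kappa> x y) < arcosh (1 + 2 * \<delta>)"
        using that 3 model_form_hav[of \<kappa> x y] by (simp add: model_dist_def field_simps)
      then show ?thesis
        using assms hav_bounds(1)[OF that(1,2)] by simp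
    qed
    moreover have "0 < arcosh (1 + 2 * \<delta>)" using assms arcosh_real_gt_1_iff[of "1 + 2 * \<delta>"] by simp
    ultimately show ?thesis using 3 by (intro exI[of _ "arcosh (1 + 2 * \<delta>) / sqrt (- \<kappa>)"]) auto
  qed
qed

lemma angle_drift:
  assumes "nested_triangles \<kappa> t" "nondegenerate \<kappa> (t 0)" "M \<le> 1 / 2048"
    and "hav_a \<kappa> (t N) \<le> M" "hav_b \<kappa> (t N) \<le> M" "hav_c \<kappa> (t N) \<le> M"
  shows "\<bar>angle_alpha \<kappa> (t (N + n)) - angle_alpha \<kappa> (t N)\<bar> \<le> 2048 * M * angle_alpha \<kappa> (t N)"
  using tail_drift[of "sgn \<kappa>" "\<lambda>n. hav_a \<kappa> (t (N + n))" "\<lambda>n. hav_b \<kappa> (t (N + n))"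
    "\<lambda>n. hav_c \<kappa> (t (N + n))" M n]
    nested_admissible[OF assms(1,2)] nested_child_sides[OF assms(1,2)] assms(3-6)
  by (simp add: nested_angle[OF assms(1,2)])

lemma angle_pos:
  assumes "nested_triangles \<kappa> t" "nondegenerate \<kappa> (t 0)"
  shows "0 < angle_alpha \<kappa> (t n)"
  using cos_sin_ang(3)[OF nested_admissible[OF assms]] by (simp add: nested_angle[OF assms])

theorem theoremB:
  fixes \<kappa> :: real
  shows "(\<forall>t. nested_triangles \<kappa> t \<and> nondegenerate \<kappa> (t 0) \<longrightarrow>
            (\<exists>l L. l > 0 \<and> L > 0 \<and>
               (\<forall>n. angle_alpha \<kappa> (t 0) * l < angle_alpha \<kappa> (t n) \<and>
                    angle_alpha \<kappa> (t n) < angle_alpha \<kappa> (t 0) * L))) \<and>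
         (\<forall>\<epsilon>>0. \<exists>\<eta>>0. \<forall>t.
            nested_triangles \<kappa> t \<and> nondegenerate \<kappa> (t 0) \<and>
            side_a \<kappa> (t 0) < \<eta> \<and> side_b \<kappa> (t 0) < \<eta> \<and> side_c \<kappa> (t 0) < \<eta> \<longrightarrow>
            (\<exists>l L. l > 0 \<and> 1 - \<epsilon> < l \<and> l < 1 \<and> 1 < L \<and> L < 1 + \<epsilon> \<and>
               (\<forall>n. angle_alpha \<kappa> (t 0) * l < angle_alpha \<kappa> (t n) \<and>
                    angle_alpha \<kappa> (t n) < angle_alpha \<kappa> (t 0) * L)))"
proof (intro conjI allI impI)
  fix t assume t: "nested_triangles \<kappa> t \<and> nondegenerate \<kappa> (t 0)"
  \<comment> \<open>With this bound the drift after step \<open>N\<close> is at most \<open>2048 / 4096\<close>, one half, of the angle.\<close>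
  then obtain N where N: "hav_a \<kappa> (t N) \<le> 1 / 4096" "hav_b \<kappa> (t N) \<le> 1 / 4096" "hav_c \<kappa> (t N) \<le> 1 / 4096"
    using nested_small[of \<kappa> t "1 / 4096"] by auto
  show "\<exists>l L. l > 0 \<and> L > 0 \<and> (\<forall>n. angle_alpha \<kappa> (t 0) * l < angle_alpha \<kappa> (t n) \<and>
                    angle_alpha \<kappa> (t n) < angle_alpha \<kappa> (t 0) * L)"
  proof (rule eventual_bounds_imp_bounds)
    show "0 < angle_alpha \<kappa> (t n)" for n using angle_pos t by blast
    show "\<bar>angle_alpha \<kappa> (t (N + n)) - angle_alpha \<kappa> (t N)\<bar> \<le> angle_alpha \<kappa> (t N) / 2" for n
      using angle_drift[of \<kappa> t "1 / 4096" N n] N t by simp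
  qed
next
  fix \<epsilon> :: real assume \<epsilon>: "0 < \<epsilon>"
  \<comment> \<open>The minimum with \<open>1\<close> keeps the lower constant positive when \<open>\<epsilon>\<close> is large.\<close>
  define e where "e = min \<epsilon> 1 / 2"
  have e: "0 < e" "e < \<epsilon>" "e < 1" using \<epsilon> by (auto simp: e_def min_def)
  define M where "M = e / 4096"
  have M: "0 < M" "M \<le> 1 / 2048" "2048 * M < e" using e by (auto simp: M_def)
  obtain \<eta> where \<eta>: "0 < \<eta>"
    "\<And>x y. x \<in> model_space \<kappa> \<Longrightarrow> y \<in> model_space \<kappa> \<Longrightarrow> model_dist \<kappa> x y < \<eta> \<Longrightarrow> hav \<kappa> x y < M"
    using hav_small_if_dist_small[OF M(1), of \<kappa>] by blast
  show "\<exists>\<eta>>0. \<forall>t.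
            nested_triangles \<kappa> t \<and> nondegenerate \<kappa> (t 0) \<and>
            side_a \<kappa> (t 0) < \<eta> \<and> side_b \<kappa> (t 0) < \<eta> \<and> side_c \<kappa> (t 0) < \<eta> \<longrightarrow>
            (\<exists>l L. l > 0 \<and> 1 - \<epsilon> < l \<and> l < 1 \<and> 1 < L \<and> L < 1 + \<epsilon> \<and>
               (\<forall>n. angle_alpha \<kappa> (t 0) * l < angle_alpha \<kappa> (t n) \<and>
                    angle_alpha \<kappa> (t n) < angle_alpha \<kappa> (t 0) * L))"
  proof (rule exI[of _ \<eta>], intro conjI allI impI)
    fix t assume t: "nested_triangles \<kappa> t \<and> nondegenerate \<kappa> (t 0) \<and>
            side_a \<kappa> (t 0) < \<eta> \<and> side_b \<kappa> (t 0) < \<eta> \<and> side_c \<kappa> (t 0) < \<eta>"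
    then have nt: "nested_triangles \<kappa> t" "nondegenerate \<kappa> (t 0)" by auto
    obtain A B C where T: "t 0 = (A, B, C)" by (cases "t 0")
    have "geodesic_triangle \<kappa> (t 0)" using nt by (simp add: nested_triangles_def)
    then have h: "hav_a \<kappa> (t 0) \<le> M" "hav_b \<kappa> (t 0) \<le> M" "hav_c \<kappa> (t 0) \<le> M"
      using t T \<eta>(2) by (auto simp: less_imp_le)
    have "angle_alpha \<kappa> (t 0) * (1 - e) < angle_alpha \<kappa> (t n) \<and>
      angle_alpha \<kappa> (t n) < angle_alpha \<kappa> (t 0) * (1 + e)" for n
    proof -
      have "2048 * M * angle_alpha \<kappa> (t 0) < e * angle_alpha \<kappa> (t 0)"
        using M(3) angle_pos[OF nt, of 0] by (intro mult_strict_right_mono)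
      then have "\<bar>angle_alpha \<kappa> (t n) - angle_alpha \<kappa> (t 0)\<bar> < e * angle_alpha \<kappa> (t 0)"
        using angle_drift[OF nt M(2) h, of n] by simp
      then show ?thesis by (simp add: algebra_simps abs_less_iff)
    qed
    then show "\<exists>l L. l > 0 \<and> 1 - \<epsilon> < l \<and> l < 1 \<and> 1 < L \<and> L < 1 + \<epsilon> \<and>
               (\<forall>n. angle_alpha \<kappa> (t 0) * l < angle_alpha \<kappa> (t n) \<and>
                    angle_alpha \<kappa> (t n) < angle_alpha \<kappa> (t 0) * L)"
      using e by (intro exI[of _ "1 - e"] exI[of _ "1 + e"]) auto
  qed (use \<eta> in simp)
qed

end
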